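(* Let $S$ be a minimal $k$-solenoid of transversal dimension $1$, and let $T$ be a transversal of $S$. Then exactly one of the following holds: (1) $T$ is a finite union of circles, and $S$ is a compact connected $(k+1)$-dimensional manifold foliated by the $k$-dimensional leaves; (2) $T$ is totally disconnected, and either (a) $T$ is finite and $S$ is a connected compact $k$-dimensional manifold (a single leaf), or (b) $T$ is a Cantor set.
   Context: A $k$-solenoid of transversal dimension $l$ is a compact subset $S$ of a $(k+l)$-dimensional foliated manifold $W$ (charts with transitions $(x,y)\mapsto(X(x,y),Y(y))$, $x\in\mathbb{R}^k,y\in\mathbb{R}^l$) which is a union of leaves of $W$, up to the natural equivalence. A flow-box is an open $U\subset S$ with a homeomorphism $\varphi:U\to D^k\times K(U)$, $K(U)\subset\mathbb{R}^l$, restricted from a foliated chart of $W$. A local transversal at $p$ is a set $T\ni p$ with $\varphi(T)=\{0\}\times K(U)$ for some flow-box $U$ around $p$; a transversal is a compact subset $T\subset S$ such that every $p\in T$ has an open neighbourhood $V$ with $V\cap T$ a local transversal at $p$. $S$ is minimal if it contains no proper nonempty compact subset which is a union of leaves. *)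

theory Defs
  imports "HOL-Analysis.Analysis"
begin

type_synonym 'a fchart = "'a set \<times> ('a \<Rightarrow> (nat \<Rightarrow> real) \<times> (nat \<Rightarrow> real))"

definition model_space :: "nat \<Rightarrow> nat \<Rightarrow> ((nat \<Rightarrow> real) \<times> (nat \<Rightarrow> real)) topology" where
  "model_space k l = prod_topology (Euclidean_space k) (Euclidean_space l)"

definition is_chart :: "'a topology \<Rightarrow> nat \<Rightarrow> nat \<Rightarrow> 'a fchart \<Rightarrow> bool" where
  "is_chart X k l c \<longleftrightarrow> (case c of (U, \<phi>) \<Rightarrow>
     openin X U \<and> openin (model_space k l) (\<phi> ` U) \<and>
     homeomorphic_map (subtopology X U) (subtopology (model_space k l) (\<phi> ` U)) \<phi>)"

text \<open>The transition from c to d has the form (x,y) |-> (X(x,y), Y(y)):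
  on the overlap, the transversal coordinate of d depends only on that of c.\<close>
definition foliated_transition :: "'a fchart \<Rightarrow> 'a fchart \<Rightarrow> bool" where
  "foliated_transition c d \<longleftrightarrow> (case c of (U, \<phi>) \<Rightarrow> case d of (V, \<psi>) \<Rightarrow>
     (\<forall>p\<in>U \<inter> V. \<forall>q\<in>U \<inter> V. snd (\<phi> p) = snd (\<phi> q) \<longrightarrow> snd (\<psi> p) = snd (\<psi> q)))"

definition foliated_manifold :: "'a topology \<Rightarrow> nat \<Rightarrow> nat \<Rightarrow> 'a fchart set \<Rightarrow> bool" where
  "foliated_manifold X k l A \<longleftrightarrow> Hausdorff_space X \<and> second_countable X \<and>
     (\<forall>c\<in>A. is_chart X k l c) \<and> \<Union> (fst ` A) = topspace X \<and>
     (\<forall>c\<in>A. \<forall>d\<in>A. foliated_transition c d)"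

text \<open>A foliated chart of W (chart of the maximal foliated atlas).\<close>
definition foliated_chart :: "'a topology \<Rightarrow> nat \<Rightarrow> nat \<Rightarrow> 'a fchart set \<Rightarrow> 'a fchart \<Rightarrow> bool" where
  "foliated_chart X k l A c \<longleftrightarrow> is_chart X k l c \<and>
     (\<forall>d\<in>A. foliated_transition c d \<and> foliated_transition d c)"

definition plaque_rel :: "'a topology \<Rightarrow> 'a fchart set \<Rightarrow> 'a \<Rightarrow> 'a \<Rightarrow> bool" where
  "plaque_rel X A p q \<longleftrightarrow> (\<exists>(U, \<phi>)\<in>A. \<exists>C. connectedin X C \<and> C \<subseteq> U \<and> p \<in> C \<and> q \<in> C \<and>
      (\<forall>z\<in>C. snd (\<phi> z) = snd (\<phi> p)))"

definition same_leaf :: "'a topology \<Rightarrow> 'a fchart set \<Rightarrow> 'a \<Rightarrow> 'a \<Rightarrow> bool" where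
  "same_leaf X A = (plaque_rel X A)\<^sup>*\<^sup>*"

definition leaf :: "'a topology \<Rightarrow> 'a fchart set \<Rightarrow> 'a \<Rightarrow> 'a set" where
  "leaf X A p = {q. same_leaf X A p q}"

definition saturated :: "'a topology \<Rightarrow> 'a fchart set \<Rightarrow> 'a set \<Rightarrow> bool" where
  "saturated X A Z \<longleftrightarrow> (\<forall>p\<in>Z. leaf X A p \<subseteq> Z)"

definition solenoid :: "'a topology \<Rightarrow> nat \<Rightarrow> nat \<Rightarrow> 'a fchart set \<Rightarrow> 'a set \<Rightarrow> bool" where
  "solenoid X k l A S \<longleftrightarrow> foliated_manifold X k l A \<and> compactin X S \<and> saturated X A S"

definition minimal_solenoid :: "'a topology \<Rightarrow> nat \<Rightarrow> nat \<Rightarrow> 'a fchart set \<Rightarrow> 'a set \<Rightarrow> bool" where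
  "minimal_solenoid X k l A S \<longleftrightarrow> solenoid X k l A S \<and>
     (\<forall>Z. Z \<subseteq> S \<and> Z \<noteq> {} \<and> compactin X Z \<and> saturated X A Z \<longrightarrow> Z = S)"

definition disc :: "nat \<Rightarrow> (nat \<Rightarrow> real) set" where
  "disc k = {x \<in> topspace (Euclidean_space k). (\<Sum>i<k. (x i)\<^sup>2) < 1}"

definition flow_box :: "'a topology \<Rightarrow> nat \<Rightarrow> nat \<Rightarrow> 'a fchart set \<Rightarrow> 'a set \<Rightarrow> 'a set
     \<Rightarrow> ('a \<Rightarrow> (nat \<Rightarrow> real) \<times> (nat \<Rightarrow> real)) \<Rightarrow> (nat \<Rightarrow> real) set \<Rightarrow> bool" where
  "flow_box X k l A S U \<phi> K \<longleftrightarrow> U \<subseteq> S \<and> openin (subtopology X S) U \<and>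
     K \<subseteq> topspace (Euclidean_space l) \<and>
     (\<exists>V \<psi>. foliated_chart X k l A (V, \<psi>) \<and> U = V \<inter> S \<and> (\<forall>z\<in>U. \<phi> z = \<psi> z)) \<and>
     homeomorphic_map (subtopology X U) (subtopology (model_space k l) (disc k \<times> K)) \<phi>"

definition local_transversal :: "'a topology \<Rightarrow> nat \<Rightarrow> nat \<Rightarrow> 'a fchart set \<Rightarrow> 'a set \<Rightarrow> 'a \<Rightarrow> 'a set \<Rightarrow> bool" where
  "local_transversal X k l A S p T \<longleftrightarrow> p \<in> T \<and>
     (\<exists>U \<phi> K. flow_box X k l A S U \<phi> K \<and> p \<in> U \<and> T \<subseteq> U \<and> \<phi> ` T = {(\<lambda>i. 0)} \<times> K)"

definition transversal :: "'a topology \<Rightarrow> nat \<Rightarrow> nat \<Rightarrow> 'a fchart set \<Rightarrow> 'a set \<Rightarrow> 'a set \<Rightarrow> bool" where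
  "transversal X k l A S T \<longleftrightarrow> T \<subseteq> S \<and> compactin X T \<and>
     (\<forall>p\<in>T. \<exists>V. openin (subtopology X S) V \<and> p \<in> V \<and> local_transversal X k l A S p (V \<inter> T))"

definition topological_manifold :: "nat \<Rightarrow> 'a topology \<Rightarrow> bool" where
  "topological_manifold n Y \<longleftrightarrow> Hausdorff_space Y \<and> second_countable Y \<and>
     (\<forall>p\<in>topspace Y. \<exists>U. openin Y U \<and> p \<in> U \<and> subtopology Y U homeomorphic_space Euclidean_space n)"

definition totally_disconnected_space :: "'a topology \<Rightarrow> bool" where
  "totally_disconnected_space Y \<longleftrightarrow> (\<forall>C\<in>connected_components_of Y. \<exists>p. C = {p})"

definition cantor_set :: "real set" where
  "cantor_set = {x. \<exists>a::nat \<Rightarrow> bool. x = (\<Sum>n. (if a n then 2 else 0) / 3 ^ Suc n)}"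

definition is_cantor_set :: "'a topology \<Rightarrow> bool" where
  "is_cantor_set Y \<longleftrightarrow> Y homeomorphic_space top_of_set cantor_set"

end

theory Submission
  imports Defs
begin

text \<open>Minimality is used only in the following way: a nonempty relatively open subset of \<open>S\<close> that
  contains, with each point, the plaque of that point in every small foliated box is all of \<open>S\<close>,
  since its complement in \<open>S\<close> is compact and saturated. Applied to the interior of \<open>S\<close>, this shows
  that \<open>S\<close> is open or has empty interior.

  If \<open>S\<close> is open, then \<open>T\<close> is a compact 1-manifold. Its components are circles: in a cover of a
  component by a minimal number of open arcs, two overlapping arcs either merge into a single arc,
  contradicting minimality, or close up to a circle, which is then open and closed.

  If \<open>S\<close> has empty interior, then \<open>T\<close> looks locally like a subset of the line without interior
  points, so that clopen sets separate the points of \<open>T\<close>. If \<open>T\<close> has an isolated point, then near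
  that point \<open>S\<close> is a single plaque; by minimality this holds everywhere, \<open>S\<close> is one compact leaf and
  \<open>T\<close> is discrete. Otherwise \<open>T\<close> is a Cantor set by Brouwer's characterisation.\<close>

section \<open>Brouwer's characterisation of the Cantor set\<close>

text \<open>A flow box is a full product \<open>disc k \<times> K\<close>. Hence an interval of
  heights inside \<open>K\<close> fills an open piece of the manifold, and conversely an open
  \<open>S\<close> forces \<open>K\<close> to be open; this is how the ambient interior of
  \<open>S\<close> controls the shape of \<open>T\<close>. Transversal dimension one enters twice: a
  subset of the line without interior can be cut at missing heights on both sides of any point, and
  compact 1-manifolds can be classified. Three obstacles shape the details. Leaves are generated by
  arbitrary connected sets inside the plaques of a chart, while boxes only control discs; membership
  is therefore shown to be locally constant along such a set. Flow boxes come from charts of the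
  maximal atlas, leaves from charts of \<open>A\<close>, so heights must be carried across
  transition maps. Two arcs may a priori overlap in many pieces; Hausdorffness makes the coordinate
  change blow up at each finite end of the overlap, so that every piece runs to an end of the first
  arc unless that arc swallows the second.\<close>

lemma countable_clopen_sets:
  assumes "compact_space Y" "second_countable Y"
  shows "countable {C. openin Y C \<and> closedin Y C}"
proof -
  obtain B where B: "countable B" "\<And>U x. openin Y U \<Longrightarrow> x \<in> U \<Longrightarrow> \<exists>V\<in>B. x \<in> V \<and> V \<subseteq> U"
      "\<And>V. V \<in> B \<Longrightarrow> openin Y V"
    using assms(2) unfolding second_countable_def by metis
  \<comment> \<open>A clopen set is compact, so finitely many of the basic sets inside it already
    fill it.\<close>
  have "{C. openin Y C \<and> closedin Y C} \<subseteq> Union ` {F. F \<subseteq> B \<and> finite F}"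
  proof clarify
    fix C assume C: "openin Y C" "closedin Y C"
    then have "compactin Y C"
      using assms(1) closedin_compact_space by blast
    moreover have "C \<subseteq> \<Union>{V\<in>B. V \<subseteq> C}"
      using B(2)[OF C(1)] by blast
    moreover have "\<And>V. V \<in> {V\<in>B. V \<subseteq> C} \<Longrightarrow> openin Y V"
      using B(3) by blast
    ultimately obtain F where F: "finite F" "F \<subseteq> {V\<in>B. V \<subseteq> C}" "C \<subseteq> \<Union>F"
      by (metis (no_types, lifting) compactinD)
    then have "C = \<Union>F" by blast
    then show "C \<in> Union ` {F. F \<subseteq> B \<and> finite F}"
      using F by blast
  qed
  moreover have "countable {F. F \<subseteq> B \<and> finite F}"
    using countable_Collect_finite_subset[OF B(1)] by (simp add: conj_commute)
  ultimately show ?thesis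
    by (rule countable_subset[OF _ countable_image])
qed

section \<open>Ternary expansions with digits 0 and 2\<close>

definition ternary :: "(nat \<Rightarrow> bool) \<Rightarrow> real" where
  "ternary a = (\<Sum>n. (if a n then 2 else 0) / 3 ^ Suc n)"

lemma geometric_third_tail_sums: "(\<lambda>n. 2 / 3 ^ Suc (n + N)) sums ((1/3) ^ N :: real)"
proof -
  have "(\<lambda>n. (2 / 3 ^ Suc N) * (1/3::real) ^ n) sums ((2 / 3 ^ Suc N) * (1 / (1 - 1/3)))"
    by (intro sums_mult geometric_sums) auto
  then show ?thesis
    by (simp add: power_add power_divide mult_ac)
qed

lemma summable_ternary: "summable (\<lambda>n. (if a n then 2 else 0) / 3 ^ Suc n :: real)"
proof (rule summable_comparison_test)
  show "summable (\<lambda>n. 2 / 3 ^ Suc n :: real)"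
    using geometric_third_tail_sums[of 0] by (simp add: sums_iff)
qed auto

text \<open>Digit differences have size at most 2, so the tail from \<open>N\<close> on is dominated
  by a geometric series with sum \<open>(1/3) ^ N\<close>. Both the continuity estimate and the
  injectivity of \<open>ternary\<close> come from this bound.\<close>

lemma ternary_diff_approx:
  "\<bar>ternary a - ternary b - (\<Sum>n<N. ((if a n then 2 else 0) - (if b n then 2 else 0)) / 3 ^ Suc n)\<bar> \<le> (1/3) ^ N"
proof -
  define d :: "nat \<Rightarrow> real" where "d n = ((if a n then 2 else 0) - (if b n then 2 else 0)) / 3 ^ Suc n" for n
  have d: "d n = (if a n then 2 else 0) / 3 ^ Suc n - (if b n then 2 else 0) / 3 ^ Suc n" for n
    by (simp add: d_def diff_divide_distrib)
  have sd: "summable d" "suminf d = ternary a - ternary b"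
    unfolding d ternary_def using summable_diff[OF summable_ternary summable_ternary]
      suminf_diff[OF summable_ternary summable_ternary] by auto
  have "ternary a - ternary b - sum d {..<N} = (\<Sum>n. d (n + N))"
    using suminf_split_initial_segment[OF sd(1), of N] sd(2) by simp
  moreover have "norm (\<Sum>n. d (n + N)) \<le> (\<Sum>n. 2 / 3 ^ Suc (n + N))"
  proof (rule norm_suminf_le)
    show "norm (d (n + N)) \<le> 2 / 3 ^ Suc (n + N)" for n
      by (simp add: d_def)
    show "summable (\<lambda>n. 2 / 3 ^ Suc (n + N) :: real)"
      using geometric_third_tail_sums sums_iff by blast
  qed
  moreover have "(\<Sum>n. 2 / 3 ^ Suc (n + N)) = (1/3::real) ^ N"
    using geometric_third_tail_sums sums_iff by blast
  ultimately show ?thesis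
    unfolding d_def by simp
qed

lemma ternary_close:
  assumes "\<And>n. n < N \<Longrightarrow> a n = b n"
  shows "\<bar>ternary a - ternary b\<bar> \<le> (1/3) ^ N"
  using ternary_diff_approx[of a b N] assms by simp

text \<open>At the first index \<open>N\<close> where the digits differ, that term has size
  \<open>2 / 3 ^ Suc N\<close>, while everything after it contributes at most
  \<open>1 / 3 ^ Suc N\<close> and cannot cancel it.\<close>

lemma inj_ternary: "inj ternary"
proof (rule injI, rule ccontr)
  fix a b assume eq: "ternary a = ternary b" and "a \<noteq> b"
  then have "\<exists>n. a n \<noteq> b n" by blast
  define N where "N = (LEAST n. a n \<noteq> b n)"
  have N: "a N \<noteq> b N" "\<And>n. n < N \<Longrightarrow> a n = b n"
    unfolding N_def using LeastI_ex[OF \<open>\<exists>n. a n \<noteq> b n\<close>] not_less_Least by blast+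
  have "\<bar>((if a N then 2 else 0) - (if b N then 2 else 0)) / 3 ^ Suc N\<bar> \<le> (1/3::real) ^ Suc N"
    using ternary_diff_approx[of a b "Suc N"] N(2) eq by simp
  then show False
    using N(1) by (auto simp: power_divide divide_le_cancel split: if_splits)
qed

lemma cantor_set_eq_range_ternary: "cantor_set = range ternary"
  by (auto simp: cantor_set_def ternary_def)

text \<open>A binary tree of nonempty clopen pieces gives each point an infinite 0-1 address. The
  address map is a bijection onto all sequences, and reading addresses as ternary expansions gives a
  continuous bijection from a compact space to a Hausdorff one.\<close>

theorem homeomorphic_cantor_set:
  assumes cpt: "compact_space Y" and sc: "second_countable Y" and ne: "topspace Y \<noteq> {}"
    and sep: "\<And>x y. \<lbrakk>x \<in> topspace Y; y \<in> topspace Y; x \<noteq> y\<rbrakk>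
                \<Longrightarrow> \<exists>C. openin Y C \<and> closedin Y C \<and> x \<in> C \<and> y \<notin> C"
    and perfect: "\<And>x. x \<in> topspace Y \<Longrightarrow> \<not> openin Y {x}"
  shows "Y homeomorphic_space top_of_set cantor_set"
proof -
  define clop where "clop = {C. openin Y C \<and> closedin Y C}"
  have clop_Int: "B \<inter> D \<in> clop" and clop_Diff: "B - D \<in> clop" if "B \<in> clop" "D \<in> clop" for B D
    using that by (auto simp: clop_def)
  have clop_ne: "clop \<noteq> {}"
    by (auto simp: clop_def)
  define C where "C = from_nat_into clop"
  have C: "range C = clop"
    unfolding C_def using countable_clopen_sets[OF cpt sc] clop_ne by (simp add: clop_def range_from_nat_into)
  txt \<open>Every stage-\<open>n\<close> piece is cut into two nonempty clopen halves, along the \<open>n\<close>-th clopen set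
    whenever that is possible; so two points that are separated by the \<open>n\<close>-th clopen set lie in
    different pieces from stage \<open>n + 1\<close> on, and no control of diameters is needed.\<close>
  define good where "good B D \<longleftrightarrow> D \<in> clop \<and> B \<inter> D \<noteq> {} \<and> B - D \<noteq> {}" for B D
  have ex_good: "\<exists>D. good B D" if "B \<in> clop" "B \<noteq> {}" for B
  proof -
    obtain x where x: "x \<in> B" using \<open>B \<noteq> {}\<close> by blast
    have B: "openin Y B" "B \<subseteq> topspace Y"
      using that(1) openin_subset by (auto simp: clop_def)
    then have "B \<noteq> {x}" using perfect x by blast
    then obtain y where y: "y \<in> B" "y \<noteq> x" using x by blast
    obtain D where "D \<in> clop" "x \<in> D" "y \<notin> D"
      using sep[of x y] x y B unfolding clop_def by blast
    then show ?thesis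
      unfolding good_def using x y by blast
  qed
  define D where "D n B = (if good B (C n) then C n else SOME D. good B D)" for n B
  have D: "good B (D n B)" if "B \<in> clop" "B \<noteq> {}" for n B
    unfolding D_def using someI_ex[OF ex_good[OF that]] by simp
  define P where "P = (\<lambda>a::nat \<Rightarrow> bool. rec_nat (topspace Y) (\<lambda>n B. if a n then B \<inter> D n B else B - D n B))"
  have P0: "P a 0 = topspace Y" and PS: "P a (Suc n) = (if a n then P a n \<inter> D n (P a n) else P a n - D n (P a n))" for a n
    by (simp_all add: P_def)
  have P: "P a n \<in> clop \<and> P a n \<noteq> {}" for a n
  proof (induction n)
    case 0 show ?case using ne by (simp add: P0 clop_def)
  next
    case (Suc n)
    with D[of "P a n" n] show ?case
      by (auto simp: PS good_def clop_Int clop_Diff)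
  qed
  have P_cong: "P a n = P b n" if "\<And>i. i < n \<Longrightarrow> a i = b i" for a b n
    using that by (induction n) (simp_all add: P0 PS)
  have P_disj: "\<forall>i<n. a i = b i" if "y \<in> P a n" "y \<in> P b n" for a b n y
    using that
  proof (induction n)
    case (Suc n)
    then have IH: "\<forall>i<n. a i = b i" by (auto simp: PS split: if_splits)
    then have "P a n = P b n" using P_cong by blast
    with Suc.prems have "a n = b n" by (auto simp: PS split: if_splits)
    with IH show ?case using less_Suc_eq by auto
  qed simp
  \<comment> \<open>\<open>P a\<close> follows a prescribed address, \<open>E y\<close> follows the
    point \<open>y\<close>. The descent along \<open>y\<close> is defined separately because the
    address \<open>f y\<close> is read off from it; \<open>EP\<close> then identifies
    \<open>E y\<close> with the branch of \<open>P\<close> at that address.\<close>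
  define E where "E y = rec_nat (topspace Y) (\<lambda>n B. if y \<in> D n B then B \<inter> D n B else B - D n B)" for y
  define f where "f y n = (y \<in> D n (E y n))" for y n
  have EP: "E y n = P (f y) n" for y n
    by (induction n) (simp_all add: E_def P_def f_def)
  have f_iff: "f y n \<longleftrightarrow> y \<in> D n (P (f y) n)" for y n
    by (simp only: f_def EP)
  have yP: "y \<in> P (f y) n" if "y \<in> topspace Y" for y n
  proof (induction n)
    case 0 then show ?case using that by (simp add: P0)
  next
    case (Suc n)
    then show ?case using f_iff[of y n] by (simp add: PS)
  qed
  have inj: "inj_on f (topspace Y)"
  proof (rule inj_onI, rule ccontr)
    fix x y assume xy: "x \<in> topspace Y" "y \<in> topspace Y" "f x = f y" "x \<noteq> y"
    then obtain K where K: "K \<in> clop" "x \<in> K" "y \<notin> K"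
      using sep unfolding clop_def by blast
    then obtain n where n: "K = C n" using C by blast
    have xy': "x \<in> P (f x) n" "y \<in> P (f x) n"
      using xy(3) yP[OF xy(1)] yP[OF xy(2)] by auto
    then have "good (P (f x) n) (C n)"
      unfolding good_def using K n by blast
    then have "D n (P (f x) n) = C n" by (simp add: D_def)
    then have "f x n" "\<not> f y n"
      using K n xy(3) f_iff[of x n] f_iff[of y n] by auto
    then show False using xy by simp
  qed
  have surj: "\<exists>y\<in>topspace Y. f y = a" for a
  proof -
    have dec: "P a (Suc n) \<subseteq> P a n" for n by (auto simp: PS)
    then have mono: "P a n \<subseteq> P a m" if "m \<le> n" for m n
      using that by (rule lift_Suc_antimono_le)
    \<comment> \<open>Compactness gives a point common to all pieces along \<open>a\<close>; since
      pieces of one stage with different addresses are disjoint, its address can only be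
      \<open>a\<close>.\<close>
    have "(\<Inter>n. P a n) \<noteq> {}"
    proof (rule compact_space_imp_nest[OF cpt])
      show "closedin Y (P a n)" "P a n \<noteq> {}" for n using P by (auto simp: clop_def)
      show "decseq (P a)" using mono by (auto simp: decseq_def)
    qed
    then obtain y where y: "\<And>n. y \<in> P a n" by blast
    then have yY: "y \<in> topspace Y" using P0 by blast
    have "f y = a"
    proof
      fix n show "f y n = a n"
        using P_disj[OF yP[OF yY] y, of "Suc n"] by blast
    qed
    then show ?thesis using yY by blast
  qed
  define F where "F = ternary \<circ> f"
  have img: "F ` topspace Y = cantor_set"
    unfolding F_def cantor_set_eq_range_ternary using surj by (auto simp: image_iff) metis
  have injF: "inj_on F (topspace Y)"
    unfolding F_def using inj inj_ternary by (meson comp_inj_on inj_on_subset subset_UNIV)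
  have cont: "continuous_map Y (top_of_set cantor_set) F"
    unfolding continuous_map_in_subtopology
  proof (intro conjI)
    show "F \<in> topspace Y \<rightarrow> cantor_set" using img by blast
    show "continuous_map Y euclideanreal F"
      unfolding mtopology_is_euclidean[symmetric] Met_TC.continuous_map_to_metric
    proof (intro ballI allI impI)
      fix x and e :: real assume x: "x \<in> topspace Y" and e: "e > 0"
      obtain N where N: "(1/3::real) ^ N < e"
        using real_arch_pow_inv[OF e, of "1/3"] by auto
      show "\<exists>U. openin Y U \<and> x \<in> U \<and> (\<forall>y\<in>U. F y \<in> Met_TC.mball (F x) e)"
      proof (intro exI conjI ballI)
        show "openin Y (P (f x) N)" using P by (auto simp: clop_def)
        show "x \<in> P (f x) N" using yP x by blast
        fix y assume y: "y \<in> P (f x) N"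
        then have yY: "y \<in> topspace Y"
          using \<open>openin Y (P (f x) N)\<close> openin_subset by blast
        have "\<bar>F x - F y\<bar> \<le> (1/3) ^ N"
          unfolding F_def o_def
          by (rule ternary_close) (use P_disj[OF y yP[OF yY]] in blast)
        then show "F y \<in> Met_TC.mball (F x) e"
          using N by (simp add: dist_real_def)
      qed
    qed
  qed
  have "homeomorphic_map Y (top_of_set cantor_set) F"
    by (rule continuous_imp_homeomorphic_map[OF cont cpt])
       (use img injF in \<open>auto simp: Hausdorff_space_subtopology\<close>)
  then show ?thesis
    by (rule homeomorphic_map_imp_homeomorphic_space)
qed

section \<open>Compact connected 1-manifolds\<close>

text \<open>An open embedding of the whole line. With all of the line as parameter domain an arc has
  no endpoints, and leaving the arc means that the parameter tends to plus or minus
  infinity.\<close>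

definition open_arc :: "'a topology \<Rightarrow> (real \<Rightarrow> 'a) \<Rightarrow> bool" where
  "open_arc Y g \<longleftrightarrow> continuous_map euclideanreal Y g \<and> open_map euclideanreal Y g \<and> inj g"

lemma open_arc_openin_range: "open_arc Y g \<Longrightarrow> openin Y (range g)"
  unfolding open_arc_def open_map_def by auto

lemma open_arc_continuous_inv:
  assumes "open_arc Y g"
  shows "continuous_map (subtopology Y (range g)) euclideanreal (inv g)"
  unfolding continuous_map_alt
proof (intro conjI allI impI)
  fix V :: "real set" assume "openin euclideanreal V"
  then have "openin Y (g ` V)"
    using assms by (auto simp: open_arc_def open_map_def)
  moreover have "inv g -` V \<inter> topspace (subtopology Y (range g)) = g ` V"
    using assms openin_subset[OF open_arc_openin_range[OF assms]]
    by (auto simp: open_arc_def)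
  ultimately show "openin (subtopology Y (range g)) (inv g -` V \<inter> topspace (subtopology Y (range g)))"
    by (metis image_mono openin_subset_topspace_eq openin_subtopology_Int2 subset_UNIV open_arc_openin_range assms openin_open_subtopology)
qed auto

text \<open>Reversal of an arc reduces decreasing coordinate changes to increasing ones, and
  overlaps at the left end of an arc to overlaps at the right end.\<close>

lemma open_arc_compose_uminus:
  assumes "open_arc Y g" shows "open_arc Y (\<lambda>s. g (- s))" "range (\<lambda>s. g (- s)) = range g"
proof -
  have "homeomorphic_map euclideanreal euclideanreal uminus"
    unfolding homeomorphic_map_maps homeomorphic_maps_def
    by (rule exI[of _ uminus]) (auto intro: continuous_intros)
  then have *: "continuous_map euclideanreal euclideanreal (uminus::real\<Rightarrow>real)" "open_map euclideanreal euclideanreal (uminus::real\<Rightarrow>real)"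
    using homeomorphic_imp_continuous_map homeomorphic_imp_open_map by blast+
  show "open_arc Y (\<lambda>s. g (- s))"
    using assms continuous_map_compose[OF *(1), of Y g] open_map_compose[OF *(2), of Y g]
    by (auto simp: open_arc_def o_def intro!: injI dest: injD)
  show "range (\<lambda>s. g (- s)) = range g"
    by (auto simp: image_iff) (metis minus_minus)
qed

text \<open>Invariance of domain in dimension one: read in the coordinate of an arc \<open>g\<close>
  near \<open>h s\<close>, the map \<open>h\<close> becomes a continuous injective real function on
  an open set, hence open. This is what certifies that a curve glued from two arcs is again an
  arc.\<close>

lemma continuous_injective_imp_open_arc:
  assumes h: "continuous_map euclideanreal Y h" "inj h"
    and cover: "\<And>s. \<exists>g. open_arc Y g \<and> h s \<in> range g"
  shows "open_arc Y h"
proof -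
  have "openin Y (h ` U)" if U: "open U" for U
  proof (subst openin_subopen, intro ballI)
    fix y assume "y \<in> h ` U"
    then obtain s where s: "s \<in> U" "y = h s" by blast
    obtain g where g: "open_arc Y g" "h s \<in> range g" using cover by blast
    define J where "J = U \<inter> h -` range g"
    have "openin euclideanreal {x \<in> topspace euclideanreal. h x \<in> range g}"
      using h(1) open_arc_openin_range[OF g(1)] by (rule openin_continuous_map_preimage)
    then have J: "open J" unfolding J_def using U by (simp add: vimage_def open_Int)
    have "continuous_map (top_of_set J) (subtopology Y (range g)) h"
      using h(1) by (auto simp: J_def continuous_map_in_subtopology continuous_map_from_subtopology)
    then have "continuous_map (top_of_set J) euclideanreal (inv g \<circ> h)"
      using open_arc_continuous_inv[OF g(1)] by (rule continuous_map_compose)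
    moreover have "inj_on (inv g \<circ> h) J"
    proof (rule inj_onI)
      fix x y assume "x \<in> J" "y \<in> J" "(inv g \<circ> h) x = (inv g \<circ> h) y"
      then have "h x = h y" unfolding J_def by (auto dest: inv_into_injective)
      then show "x = y" using h(2) by (simp add: inj_eq)
    qed
    ultimately have "open ((inv g \<circ> h) ` J)"
      using injective_into_1d_imp_open_map_UNIV[OF J _ _ order_refl, of "inv g \<circ> h"] by auto
    then have "openin Y (g ` (inv g \<circ> h) ` J)"
      using g(1) by (auto simp: open_arc_def open_map_def)
    moreover have "g ` (inv g \<circ> h) ` J = h ` J"
    proof -
      have "g (inv g (h x)) = h x" if "x \<in> J" for x
        using that by (auto simp: J_def f_inv_into_f)
      then show ?thesis by (simp add: image_image)
    qed
    moreover have "y \<in> h ` J" "h ` J \<subseteq> h ` U"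
      using s g by (auto simp: J_def)
    ultimately show "\<exists>T. openin Y T \<and> y \<in> T \<and> T \<subseteq> h ` U" by metis
  qed
  then show ?thesis
    using h by (simp add: open_arc_def open_map_def)
qed

section \<open>How two open arcs in a Hausdorff space can overlap\<close>

locale arc_overlap =
  fixes Y :: "'a topology" and g1 g2 :: "real \<Rightarrow> 'a"
  assumes Haus: "Hausdorff_space Y" and arc1: "open_arc Y g1" and arc2: "open_arc Y g2"
begin

definition I where "I = {s. g1 s \<in> range g2}"
text \<open>The change of parameter from \<open>g1\<close> to \<open>g2\<close>; its values carry
  meaning only on the overlap \<open>I\<close>.\<close>

definition t where "t = inv g2 \<circ> g1"

lemma g2_t: "s \<in> I \<Longrightarrow> g2 (t s) = g1 s"
  by (auto simp: I_def t_def f_inv_into_f)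

lemma t_unique: "g1 s = g2 u \<Longrightarrow> s \<in> I \<and> t s = u"
  using arc2 by (auto simp: I_def t_def open_arc_def)

lemma open_I: "open I"
proof -
  have "openin euclideanreal {x \<in> topspace euclideanreal. g1 x \<in> range g2}"
    using arc1 open_arc_openin_range[OF arc2]
    by (intro openin_continuous_map_preimage) (auto simp: open_arc_def)
  then show ?thesis by (simp add: I_def)
qed

lemma inj_t: "inj_on t I"
  by (rule inj_onI) (metis arc1 g2_t injD open_arc_def)

lemma continuous_t: "continuous_on I t"
proof -
  have "continuous_map (top_of_set I) (subtopology Y (range g2)) g1"
    using arc1 by (auto simp: I_def open_arc_def continuous_map_in_subtopology continuous_map_from_subtopology)
  then have "continuous_map (top_of_set I) euclideanreal t"
    unfolding t_def using open_arc_continuous_inv[OF arc2] by (rule continuous_map_compose)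
  then show ?thesis by simp
qed

text \<open>Hausdorffness enters here: \<open>g2 ` {-M..M}\<close> is closed, so it stays away from \<open>g1 a\<close>.\<close>

lemma t_blows_up:
  assumes "a \<notin> I"
  obtains e where "e > 0" "\<And>s. s \<in> I \<Longrightarrow> \<bar>s - a\<bar> < e \<Longrightarrow> \<bar>t s\<bar> > M"
proof -
  have "compactin Y (g2 ` {-M..M})"
    using arc2 by (intro image_compactin[of euclideanreal]) (auto simp: open_arc_def)
  then have "closedin Y (g2 ` {-M..M})"
    using Haus compactin_imp_closedin by blast
  then have "closedin euclideanreal {x \<in> topspace euclideanreal. g1 x \<in> g2 ` {-M..M}}"
    using arc1 by (intro closedin_continuous_map_preimage[of _ Y]) (auto simp: open_arc_def)
  then have "open (- {x. g1 x \<in> g2 ` {-M..M}})" by (simp add: open_Compl)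
  moreover have "a \<in> - {x. g1 x \<in> g2 ` {-M..M}}"
    using assms by (auto simp: I_def)
  ultimately obtain e where e: "e > 0" "ball a e \<subseteq> - {x. g1 x \<in> g2 ` {-M..M}}"
    using open_contains_ball by blast
  show thesis
  proof (rule that[OF e(1)])
    fix s assume s: "s \<in> I" "\<bar>s - a\<bar> < e"
    then have "g1 s \<notin> g2 ` {-M..M}"
      using e(2) by (auto simp: dist_real_def abs_minus_commute subset_iff)
    then have "t s \<notin> {-M..M}" using g2_t[OF s(1)] by (metis image_eqI)
    then show "\<bar>t s\<bar> > M" by auto
  qed
qed

text \<open>By \<open>t_blows_up\<close> the size of \<open>t\<close> explodes at \<open>a\<close>,
  and an increasing function can only explode downwards at a left end.\<close>

lemma mono_unbounded_below:
  assumes "a \<notin> I" "a < b" "{a<..<b} \<subseteq> I" "strict_mono_on {a<..<b} t"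
  shows "\<exists>s\<in>{a<..<b}. t s < y"
proof -
  define s1 where "s1 = (a + b) / 2"
  \<comment> \<open>The bound \<open>\<bar>t s1\<bar>\<close> fixes the sign:
    \<open>t s < t s1\<close> together with \<open>\<bar>t s\<bar> > \<bar>t s1\<bar>\<close> makes
    \<open>t s\<close> negative. The bound \<open>\<bar>y\<bar>\<close> then pushes it below
    \<open>y\<close>.\<close>
  obtain e where e: "e > 0" "\<And>s. s \<in> I \<Longrightarrow> \<bar>s - a\<bar> < e \<Longrightarrow> \<bar>t s\<bar> > max \<bar>y\<bar> \<bar>t s1\<bar>"
    using t_blows_up[OF assms(1)] by blast
  define s where "s = a + min (e/2) ((b - a) / 4)"
  have s: "a < s" "s < s1" "s1 < b" "\<bar>s - a\<bar> < e"
    using e(1) assms(2) by (auto simp: s_def s1_def min_def field_simps)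
  then have "s \<in> I" using assms(3) by auto
  then have "\<bar>t s\<bar> > max \<bar>y\<bar> \<bar>t s1\<bar>" using e(2) s by blast
  moreover have "t s < t s1"
    using assms(4) s by (auto simp: strict_mono_on_def)
  ultimately have "t s < y" by linarith
  then show ?thesis using s by auto
qed

lemma mono_unbounded_above:
  assumes "b \<notin> I" "a < b" "{a<..<b} \<subseteq> I" "strict_mono_on {a<..<b} t"
  shows "\<exists>s\<in>{a<..<b}. y < t s"
proof -
  define s1 where "s1 = (a + b) / 2"
  obtain e where e: "e > 0" "\<And>s. s \<in> I \<Longrightarrow> \<bar>s - b\<bar> < e \<Longrightarrow> \<bar>t s\<bar> > max \<bar>y\<bar> \<bar>t s1\<bar>"
    using t_blows_up[OF assms(1)] by blast
  define s where "s = b - min (e/2) ((b - a) / 4)"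
  have s: "s < b" "s1 < s" "a < s1" "\<bar>s - b\<bar> < e"
    using e(1) assms(2) by (auto simp: s_def s1_def min_def field_simps)
  then have "s \<in> I" using assms(3) by auto
  then have "\<bar>t s\<bar> > max \<bar>y\<bar> \<bar>t s1\<bar>" using e(2) s by blast
  moreover have "t s1 < t s"
    using assms(4) s by (auto simp: strict_mono_on_def)
  ultimately have "y < t s" by linarith
  then show ?thesis using s by auto
qed

lemma t_attains:
  assumes "{u..v} \<subseteq> I" "u \<le> v" "t u \<le> y" "y \<le> t v"
  shows "\<exists>s\<in>{u..v}. t s = y"
  using IVT'[of t u y v] assms continuous_on_subset[OF continuous_t assms(1)] by auto

lemma arc_overlap_reflect2: "arc_overlap Y g1 (\<lambda>s. g2 (- s))"
  using Haus arc1 arc2 open_arc_compose_uminus by unfold_locales auto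

lemma arc_overlap_reflect1: "arc_overlap Y (\<lambda>s. g1 (- s)) g2"
  using Haus arc1 arc2 open_arc_compose_uminus by unfold_locales auto

lemma I_reflect2: "arc_overlap.I g1 (\<lambda>s. g2 (- s)) = I"
  unfolding arc_overlap.I_def[OF arc_overlap_reflect2] I_def
  using open_arc_compose_uminus(2)[OF arc2] by simp

lemma t_reflect2: assumes "s \<in> I" shows "arc_overlap.t g1 (\<lambda>s. g2 (- s)) s = - t s"
  using arc_overlap.t_unique[OF arc_overlap_reflect2, of s "- t s"] g2_t[OF assms] by simp

lemma monotone_t:
  assumes "is_interval J" "J \<subseteq> I"
  shows "strict_mono_on J t \<or> strict_antimono_on J t"
  using injective_eq_monotone_map[OF assms(1) continuous_on_subset[OF continuous_t assms(2)]]
    inj_on_subset[OF inj_t assms(2)] by blast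

text \<open>On a bounded component of \<open>I\<close> an increasing \<open>t\<close> runs from
  minus infinity to plus infinity, so by the intermediate value theorem this stretch of
  \<open>g1\<close> passes through every point of \<open>g2\<close>.\<close>

lemma blocked_mono:
  assumes "a \<notin> I" "b \<notin> I" "a < b" "{a<..<b} \<subseteq> I" "strict_mono_on {a<..<b} t"
  shows "range g2 \<subseteq> range g1"
proof clarify
  fix y
  obtain u v where uv: "u \<in> {a<..<b}" "t u < y" "v \<in> {a<..<b}" "y < t v"
    using mono_unbounded_below[OF assms(1,3-5)] mono_unbounded_above[OF assms(2-5)] by blast
  have "u < v"
    using strict_mono_on_leD[OF assms(5) uv(3,1)] uv by force
  then obtain s where "s \<in> {u..v}" "t s = y"
    using t_attains[of u v y] uv assms(4) by (auto simp: subset_iff)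
  then have "g1 s = g2 y" using g2_t[of s] assms(4) uv by (force simp: subset_iff)
  then show "g2 y \<in> range g1" by (metis rangeI)
qed

lemma blocked_gap:
  assumes "a \<notin> I" "b \<notin> I" "a < b" "{a<..<b} \<subseteq> I"
  shows "range g2 \<subseteq> range g1"
  using monotone_t[OF _ assms(4)]
proof
  assume "strict_mono_on {a<..<b} t"
  then show ?thesis using blocked_mono assms by blast
next
  assume "strict_antimono_on {a<..<b} t"
  then have "strict_mono_on {a<..<b} (arc_overlap.t g1 (\<lambda>s. g2 (- s)))"
    using assms(4) by (auto simp: monotone_on_def t_reflect2 subset_iff)
  then show ?thesis
    using arc_overlap.blocked_mono[OF arc_overlap_reflect2, of a b] assms I_reflect2
      open_arc_compose_uminus(2)[OF arc2] by simp
qed (auto simp: is_interval_oo)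

text \<open>\<open>I\<close> is open, so the parameters of \<open>{a0..s}\<close> outside it form a
  closed set, and its supremum is the left end of the component of \<open>I\<close> containing
  \<open>s\<close>.\<close>

lemma left_end:
  assumes "s \<in> I" "a0 \<notin> I" "a0 < s"
  obtains a where "a \<notin> I" "a0 \<le> a" "a < s" "{a<..s} \<subseteq> I"
proof -
  define Z where "Z = {a0..s} - I"
  have "a0 \<in> Z" using assms by (simp add: Z_def)
  then have Z: "closed Z" "Z \<noteq> {}" "bdd_above Z"
    using open_I by (auto simp: Z_def closed_Diff)
  have SZ: "Sup Z \<in> Z" by (rule closed_contains_Sup[OF Z(2,3,1)])
  show thesis
  proof (rule that[of "Sup Z"])
    show "Sup Z \<notin> I" "a0 \<le> Sup Z" "Sup Z < s"
      using SZ assms by (auto simp: Z_def order.order_iff_strict)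
    show "{Sup Z<..s} \<subseteq> I"
    proof
      fix x assume x: "x \<in> {Sup Z<..s}"
      then have "x \<notin> Z" using cSup_upper[OF _ Z(3)] by force
      then show "x \<in> I" using x \<open>a0 \<le> Sup Z\<close> by (auto simp: Z_def)
    qed
  qed
qed

lemma right_end:
  assumes "s \<in> I" "b0 \<notin> I" "s < b0"
  obtains b where "b \<notin> I" "b \<le> b0" "s < b" "{s..<b} \<subseteq> I"
proof -
  define Z where "Z = {s..b0} - I"
  have "b0 \<in> Z" using assms by (simp add: Z_def)
  then have Z: "closed Z" "Z \<noteq> {}" "bdd_below Z"
    using open_I by (auto simp: Z_def closed_Diff)
  have SZ: "Inf Z \<in> Z" by (rule closed_contains_Inf[OF Z(2,3,1)])
  show thesis
  proof (rule that[of "Inf Z"])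
    show "Inf Z \<notin> I" "Inf Z \<le> b0" "s < Inf Z"
      using SZ assms by (auto simp: Z_def order.order_iff_strict)
    show "{s..<Inf Z} \<subseteq> I"
    proof
      fix x assume x: "x \<in> {s..<Inf Z}"
      then have "x \<notin> Z" using cInf_lower[OF _ Z(3)] by force
      then show "x \<in> I" using x \<open>Inf Z \<le> b0\<close> by (auto simp: Z_def)
    qed
  qed
qed

text \<open>A bounded component of \<open>I\<close> would make \<open>g1\<close> swallow
  \<open>g2\<close>. Hence every component is unbounded: \<open>I\<close> is empty, a ray, two
  disjoint opposite rays, or the whole line.\<close>

lemma not_blocked:
  assumes "\<not> range g2 \<subseteq> range g1" "s \<in> I" "a \<notin> I" "b \<notin> I" "a < s" "s < b"
  shows False
proof -
  obtain a' where a': "a' \<notin> I" "a' < s" "{a'<..s} \<subseteq> I" using left_end assms by metis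
  obtain b' where b': "b' \<notin> I" "s < b'" "{s..<b'} \<subseteq> I" using right_end assms by metis
  have "{a'<..<b'} \<subseteq> {a'<..s} \<union> {s..<b'}" by auto
  then have "{a'<..<b'} \<subseteq> I" using a' b' by blast
  then show False using blocked_gap[of a' b'] a' b' assms(1) by auto
qed

text \<open>Follow \<open>g1\<close> up to the junction \<open>m\<close>, then continue along
  \<open>g2\<close> at unit speed from \<open>t m\<close>; the two pieces agree at \<open>m\<close>
  by \<open>g2_t\<close>. If \<open>t\<close> increases near \<open>m\<close>, the path does not
  turn back.\<close>

definition glue where "glue m s = (if s \<le> m then g1 s else g2 (t m + (s - m)))"

lemma continuous_glue: assumes "m \<in> I" shows "continuous_map euclideanreal Y (glue m)"
proof -
  have "continuous_on UNIV (\<lambda>s. t m + (s - m))" by (intro continuous_intros)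
  then have "continuous_map euclideanreal Y (\<lambda>s. g2 (t m + (s - m)))"
    using continuous_map_compose[of euclideanreal euclideanreal "\<lambda>s. t m + (s - m)" Y g2] arc2
    by (auto simp: open_arc_def o_def)
  then show ?thesis
    unfolding glue_def using arc1 g2_t[OF assms]
    by (intro continuous_map_cases_le)
       (auto simp: open_arc_def intro: continuous_map_from_subtopology)
qed

text \<open>As \<open>t\<close> increases from minus infinity at \<open>a\<close>, the beginning of
  \<open>g2\<close> lies along the end of \<open>g1\<close>, and switching from one to the other
  prolongs \<open>g1\<close>. If the overlap is only this ray, the result is an arc. A second
  overlap lies at the opposite end of \<open>g1\<close>; there \<open>g2\<close> comes back to the
  beginning of \<open>g1\<close>, and the glued path closes up.\<close>

lemma merge_mono:
  assumes nsub: "\<not> range g2 \<subseteq> range g1" and a: "a \<notin> I" "{a<..} \<subseteq> I" "strict_mono_on {a<..} t"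
  shows "(\<exists>h. open_arc Y h \<and> range h = range g1 \<union> range g2) \<or>
         (\<exists>(\<gamma>::real \<Rightarrow> 'a) p q. p < q \<and> continuous_map (top_of_set {p..q}) Y \<gamma> \<and> \<gamma> p = \<gamma> q \<and>
            inj_on \<gamma> {p..<q} \<and> \<gamma> ` {p..q} = range g1 \<union> range g2)"
proof -
  define m where "m = a + 1"
  have m: "a < m" "m \<in> I" using a(2) by (auto simp: m_def)
  \<comment> \<open>Everything on \<open>g2\<close> up to the junction already lies on the stretch
    of \<open>g1\<close> between \<open>a\<close> and \<open>m\<close>.\<close>
  have below: "\<exists>s. a < s \<and> s \<le> m \<and> t s = u" if "u \<le> t m" for u
  proof -
    have "\<exists>s\<in>{a<..<m}. t s < u"
      by (rule mono_unbounded_below) (use a m in \<open>auto simp: monotone_on_def\<close>)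
    then obtain s where s: "a < s" "s < m" "t s < u" by auto
    then obtain x where "x \<in> {s..m}" "t x = u"
      using t_attains[of s m u] \<open>u \<le> t m\<close> a(2) by (auto simp: subset_iff)
    then show ?thesis using s by (intro exI[of _ x]) auto
  qed
  have t_less: "t s < t s' \<longleftrightarrow> s < s'" if "a < s" "a < s'" for s s'
    using a(3) that by (metis greaterThan_iff less_asym linorder_neqE strict_mono_onD)
  show ?thesis
  proof (cases "I = {a<..}")
    case True
    have inj: "inj (glue m)"
    proof (rule injI)
      fix x y assume eq: "glue m x = glue m y"
      have mixed: False if "x \<le> m" "m < y" "g1 x = g2 (t m + (y - m))" for x y
        using t_unique[OF that(3)] True t_less[of m x] m that by auto
      show "x = y"
        using eq mixed[of x y] mixed[of y x] arc1 arc2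
        by (auto simp: glue_def open_arc_def inj_eq split: if_splits)
    qed
    have range: "range (glue m) = range g1 \<union> range g2"
    proof
      show "range (glue m) \<subseteq> range g1 \<union> range g2" by (auto simp: glue_def)
      have "g1 s \<in> range (glue m)" for s
      proof (cases "s \<le> m")
        case True then show ?thesis by (intro image_eqI[of _ _ s]) (auto simp: glue_def)
      next
        case False
        then have "g1 s = glue m (t s - t m + m)"
          using g2_t[of s] t_less[of m s] m True by (auto simp: glue_def)
        then show ?thesis by blast
      qed
      moreover have "g2 u \<in> range (glue m)" for u
      proof (cases "u \<le> t m")
        case True
        then obtain s where s: "a < s" "s \<le> m" "t s = u" using below by blast
        then have "glue m s = g2 u" using g2_t[of s] a(2) by (auto simp: glue_def)
        then show ?thesis by (metis rangeI)
      next
        case False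
        then have "g2 u = glue m (u - t m + m)" by (auto simp: glue_def)
        then show ?thesis by blast
      qed
      ultimately show "range g1 \<union> range g2 \<subseteq> range (glue m)" by blast
    qed
    have "open_arc Y (glue m)"
      by (rule continuous_injective_imp_open_arc[OF continuous_glue[OF m(2)] inj])
         (metis glue_def arc1 arc2 rangeI)
    then show ?thesis using range by blast
  next
    case False
    \<comment> \<open>An overlap point outside the ray lies left of \<open>a\<close>. Its component
      ends at some \<open>b \<le> a\<close>, so by \<open>not_blocked\<close> it extends to minus
      infinity, and \<open>I\<close> consists of exactly \<open>{..<b}\<close> and
      \<open>{a<..}\<close>.\<close>
    then obtain s1 where s1: "s1 \<in> I" "s1 < a"
      using a by (metis greaterThan_iff linorder_neqE subsetI subset_antisym)
    obtain b where b: "b \<notin> I" "b \<le> a" "s1 < b" "{s1..<b} \<subseteq> I"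
      using right_end[OF s1(1) a(1) s1(2)] by metis
    have lower: "{..<b} \<subseteq> I"
    proof
      fix x assume x: "x \<in> {..<b}"
      show "x \<in> I"
      proof (rule ccontr)
        assume "x \<notin> I"
        then have "x < s1" using x b by (metis atLeastLessThan_iff leI lessThan_iff subsetD)
        then show False using not_blocked[OF nsub s1(1) \<open>x \<notin> I\<close> a(1)] s1 by blast
      qed
    qed
    have Ib: "s < b" if "s \<in> I" "s < a" for s
      using not_blocked[OF nsub that(1) b(1) a(1)] that b(1) by (metis linorder_neqE)
    \<comment> \<open>The values up to \<open>t m\<close> are already taken to the right of
      \<open>a\<close>, and \<open>t\<close> is injective.\<close>
    have above_m: "t m < t s" if "s < b" for s
    proof (rule ccontr)
      assume "\<not> t m < t s"
      then obtain s' where s': "a < s'" "t s' = t s" using below[of "t s"] by auto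
      have "s' = s" using inj_onD[OF inj_t s'(2)] s' a(2) lower that by auto
      then show False using s' b that by auto
    qed
    \<comment> \<open>A decreasing \<open>t\<close> would tend to minus infinity at
      \<open>b\<close>, below the bound \<open>t m\<close> just obtained.\<close>
    have mono: "strict_mono_on {..<b} t"
    proof (rule ccontr)
      assume "\<not> strict_mono_on {..<b} t"
      then have "strict_antimono_on {..<b} t"
        using monotone_t[OF _ lower] by (auto simp: is_interval_io)
      then have "strict_mono_on {b-1<..<b} (arc_overlap.t g1 (\<lambda>s. g2 (- s)))"
        using lower by (auto simp: monotone_on_def t_reflect2 subset_iff)
      then have "\<exists>s\<in>{b-1<..<b}. - t m < arc_overlap.t g1 (\<lambda>s. g2 (- s)) s"
        using lower b(1) by (intro arc_overlap.mono_unbounded_above[OF arc_overlap_reflect2])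
          (auto simp: I_reflect2)
      then obtain s where "s \<in> {b-1<..<b}" "- t m < arc_overlap.t g1 (\<lambda>s. g2 (- s)) s" by blast
      then have "s < b" "t s < t m" using t_reflect2[of s] lower by auto
      then show False using above_m[of s] by simp
    qed
    define n where "n = b - 1"
    have n: "n < b" "n \<in> I" using lower by (auto simp: n_def)
    have above: "\<exists>s. n \<le> s \<and> s < b \<and> t s = u" if "t n \<le> u" for u
    proof -
      have "\<exists>s\<in>{n<..<b}. u < t s"
        by (rule mono_unbounded_above) (use b n lower mono in \<open>auto simp: monotone_on_def\<close>)
      then obtain s where s: "n < s" "s < b" "u < t s" by auto
      then obtain x where "x \<in> {n..s}" "t x = u"
        using t_attains[of n s u] \<open>t n \<le> u\<close> lower by (auto simp: subset_iff)
      then show ?thesis using s by (intro exI[of _ x]) auto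
    qed
    have below_n: "t s < t n" if "a < s" for s
    proof (rule ccontr)
      assume "\<not> t s < t n"
      then obtain s' where s': "s' < b" "t s' = t s" using above[of "t s"] by auto
      have "s' = s" using inj_onD[OF inj_t s'(2)] s' a(2) lower that by auto
      then show False using s' b that by auto
    qed
    have mn: "t m < t n" using above_m n by blast
    have nm: "n < m" using n m b by linarith
    \<comment> \<open>At \<open>q\<close> the second piece has reached the parameter
      \<open>t n\<close> of \<open>g2\<close>, that is, the point \<open>g1 n\<close> at which the
      path started.\<close>
    define q where "q = m + (t n - t m)"
    have q: "m < q" using mn by (simp add: q_def)
    have cont: "continuous_map (top_of_set {n..q}) Y (glue m)"
      using continuous_glue[OF m(2)] by (rule continuous_map_from_subtopology)
    have ends: "glue m n = glue m q"
      using g2_t[OF n(2)] q nm by (auto simp: glue_def q_def)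
    have inj: "inj_on (glue m) {n..<q}"
    proof (rule inj_onI)
      fix x y assume xy: "x \<in> {n..<q}" "y \<in> {n..<q}" and eq: "glue m x = glue m y"
      \<comment> \<open>The two pieces of the loop could only meet in overlap points. Those on
        \<open>{a<..m}\<close> have \<open>t\<close>-value at most \<open>t m\<close>, those on
        \<open>{n..<b}\<close> have \<open>t\<close>-value at least \<open>t n\<close>, and the
        second piece uses only parameters strictly between.\<close>
      have mixed: False if "n \<le> x" "x \<le> m" "m < y" "y < q" "g1 x = g2 (t m + (y - m))" for x y
      proof -
        have tx: "x \<in> I" "t x = t m + (y - m)" using t_unique[OF that(5)] by auto
        show False
        proof (cases "a < x")
          case True
          then show False using t_less[of m x] m that tx by auto
        next
          case False
          then have "x < b" using Ib[OF tx(1)] a(1) tx(1) by (metis linorder_neqE)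
          then have "t n \<le> t x" using mono that(1) n by (metis lessThan_iff strict_mono_on_leD)
          then show False using tx(2) that(4) by (simp add: q_def)
        qed
      qed
      show "x = y"
        using xy eq mixed[of x y] mixed[of y x] arc1 arc2
        by (auto simp: glue_def open_arc_def inj_eq split: if_splits)
    qed
    have img: "glue m ` {n..q} = range g1 \<union> range g2"
    proof
      show "glue m ` {n..q} \<subseteq> range g1 \<union> range g2" by (auto simp: glue_def)
      have G2: "g2 u \<in> glue m ` {n..q}" if "t m \<le> u" "u \<le> t n" for u
      proof (rule image_eqI)
        show "g2 u = glue m (u - t m + m)" using that g2_t[OF m(2)] by (auto simp: glue_def)
        show "u - t m + m \<in> {n..q}" using that nm by (auto simp: q_def)
      qed
      have G1: "g1 s \<in> glue m ` {n..q}" for s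
      proof -
        consider "s < n" | "n \<le> s" "s \<le> m" | "m < s" by linarith
        then show ?thesis
        proof cases
          case 1
          then have "s < b" using n by linarith
          then have "t m < t s" "s \<in> I" using above_m lower by auto
          moreover have "t s \<le> t n" using mono 1 n \<open>s < b\<close>
            by (metis lessThan_iff less_imp_le strict_mono_on_leD)
          ultimately show ?thesis using G2[of "t s"] g2_t[of s] by auto
        next
          case 2 then show ?thesis using q by (intro image_eqI[of _ _ s]) (auto simp: glue_def)
        next
          case 3
          then have "t m < t s" "t s < t n" "s \<in> I" using below_n t_less m a(2) by auto
          then show ?thesis using G2[of "t s"] g2_t[of s] by auto
        qed
      qed
      have "g2 u \<in> glue m ` {n..q}" for u
      proof -
        consider "u \<le> t m" | "t m \<le> u" "u \<le> t n" | "t n \<le> u" by linarith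
        then show ?thesis
        proof cases
          case 1
          then obtain s where "a < s" "t s = u" using below by blast
          then have "g2 u = g1 s" using g2_t[of s] a(2) by auto
          then show ?thesis using G1 by simp
        next
          case 2 then show ?thesis by (rule G2)
        next
          case 3
          then obtain s where "s < b" "t s = u" using above by blast
          then have "g2 u = g1 s" using g2_t[of s] lower by auto
          then show ?thesis using G1 by simp
        qed
      qed
      then show "range g1 \<union> range g2 \<subseteq> glue m ` {n..q}" using G1 by blast
    qed
    show ?thesis
      by (rule disjI2, rule exI[of _ "glue m"], rule exI[of _ n], rule exI[of _ q])
         (use cont ends inj img nm q in auto)
  qed
qed

lemma merge_right:
  assumes nsub: "\<not> range g2 \<subseteq> range g1" and a: "a \<notin> I" "{a<..} \<subseteq> I"
  shows "(\<exists>h. open_arc Y h \<and> range h = range g1 \<union> range g2) \<or>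
         (\<exists>(\<gamma>::real \<Rightarrow> 'a) p q. p < q \<and> continuous_map (top_of_set {p..q}) Y \<gamma> \<and> \<gamma> p = \<gamma> q \<and>
            inj_on \<gamma> {p..<q} \<and> \<gamma> ` {p..q} = range g1 \<union> range g2)"
  using monotone_t[OF _ a(2)]
proof
  assume "strict_mono_on {a<..} t"
  then show ?thesis using merge_mono assms by blast
next
  assume "strict_antimono_on {a<..} t"
  then have "strict_mono_on {a<..} (arc_overlap.t g1 (\<lambda>s. g2 (- s)))"
    using a(2) by (auto simp: monotone_on_def t_reflect2 subset_iff)
  then show ?thesis
    using arc_overlap.merge_mono[OF arc_overlap_reflect2, of a] assms I_reflect2
      open_arc_compose_uminus(2)[OF arc2] by simp
qed (auto simp: is_interval_oi)

end

text \<open>Since neither arc contains the other, the overlap has a component with one finite end,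
  and it reaches an end of \<open>g1\<close>. If that is the right end, \<open>merge_right\<close>
  applies; otherwise it applies to the reversed \<open>g1\<close>.\<close>

proposition open_arcs_merge:
  fixes Y :: "'a topology"
  assumes "Hausdorff_space Y" "open_arc Y g1" "open_arc Y g2" "range g1 \<inter> range g2 \<noteq> {}"
    "\<not> range g2 \<subseteq> range g1" "\<not> range g1 \<subseteq> range g2"
  obtains h where "open_arc Y h" "range h = range g1 \<union> range g2"
    | \<gamma> and p q :: real where "p < q" "continuous_map (top_of_set {p..q}) Y \<gamma>" "\<gamma> p = \<gamma> q"
        "inj_on \<gamma> {p..<q}" "\<gamma> ` {p..q} = range g1 \<union> range g2"
proof -
  interpret arc_overlap Y g1 g2 using assms by unfold_locales
  interpret R: arc_overlap Y "\<lambda>s. g1 (- s)" g2 by (rule arc_overlap_reflect1)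
  obtain s where s: "s \<in> I" using assms(4) by (auto simp: I_def)
  obtain x where x: "x \<notin> I" using assms(6) by (auto simp: I_def)
  have RI: "u \<in> R.I \<longleftrightarrow> - u \<in> I" for u by (simp add: R.I_def I_def)
  have "x \<noteq> s" using s x by blast
  then consider "x < s" | "s < x" by linarith
  then have "(\<exists>h. open_arc Y h \<and> range h = range g1 \<union> range g2) \<or>
         (\<exists>(\<gamma>::real \<Rightarrow> 'a) p q. p < q \<and> continuous_map (top_of_set {p..q}) Y \<gamma> \<and> \<gamma> p = \<gamma> q \<and>
            inj_on \<gamma> {p..<q} \<and> \<gamma> ` {p..q} = range g1 \<union> range g2)"
  proof cases
    case 1
    then obtain a where a: "a \<notin> I" "a < s" "{a<..s} \<subseteq> I" using left_end[OF s x] by metis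
    have "u \<in> I" if "a < u" for u
    proof (rule ccontr)
      assume "u \<notin> I"
      moreover have "s < u" using a that \<open>u \<notin> I\<close> by (metis greaterThanAtMost_iff leI subsetD)
      ultimately show False using not_blocked[OF assms(5) s a(1)] a(2) by blast
    qed
    then show ?thesis using merge_right[OF assms(5) a(1)] by blast
  next
    case 2
    then obtain b where b: "b \<notin> I" "s < b" "{s..<b} \<subseteq> I" using right_end[OF s x] by metis
    have *: "u \<in> I" if "u < b" for u
    proof (rule ccontr)
      assume "u \<notin> I"
      moreover have "u < s" using b that \<open>u \<notin> I\<close> by (metis atLeastLessThan_iff leI subsetD)
      ultimately show False using not_blocked[OF assms(5) s _ b(1)] b(2) by blast
    qed
    have "- b \<notin> R.I" "{- b<..} \<subseteq> R.I" using b(1) * by (auto simp: RI)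
    then show ?thesis
      using R.merge_right[of "- b"] assms(5) open_arc_compose_uminus(2)[OF assms(2)] by simp
  qed
  then show thesis using that by blast
qed

text \<open>The standard winding map \<open>e\<close> is a quotient map that identifies only the
  endpoints of \<open>{p..q}\<close>, and \<open>\<gamma>\<close> identifies these as well. So
  \<open>\<gamma>\<close> descends to the circle, where it becomes a continuous bijection from a
  compact space to a Hausdorff one.\<close>

lemma closed_curve_homeomorphic_circle:
  fixes \<gamma> :: "real \<Rightarrow> 'a"
  assumes "p < q" and \<gamma>: "continuous_map (top_of_set {p..q}) Y \<gamma>" "\<gamma> p = \<gamma> q" "inj_on \<gamma> {p..<q}"
    "\<gamma> ` {p..q} = topspace Y" and Haus: "Hausdorff_space Y"
  shows "Y homeomorphic_space nsphere 1"
proof -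
  define \<theta> where "\<theta> s = 2 * pi * ((s - p) / (q - p))" for s
  \<comment> \<open>One full turn of the unit circle. Points of \<open>nsphere 1\<close> are
    sequences, so the two coordinates are padded with zeros.\<close>
  define e where "e s = (\<lambda>i::nat. if i < 2 then (if i = 0 then cos (\<theta> s) else sin (\<theta> s)) else 0)" for s
  have top: "topspace (nsphere 1) = {x. (x 0)\<^sup>2 + (x 1)\<^sup>2 = 1 \<and> (\<forall>i\<ge>2. x i = 0)}"
    by (auto simp: nsphere)
  have cont: "continuous_map (top_of_set {p..q}) (nsphere 1) e"
    unfolding nsphere_def continuous_map_in_subtopology
  proof
    have "continuous_on {p..q} (\<lambda>s. cos (\<theta> s))" "continuous_on {p..q} (\<lambda>s. sin (\<theta> s))"
      unfolding \<theta>_def using \<open>p < q\<close> by (intro continuous_intros; simp)+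
    then show "continuous_map (top_of_set {p..q}) (Euclidean_space (Suc 1)) e"
      unfolding e_def using continuous_map_componentwise_Euclidean_space[of "top_of_set {p..q}" 2
        "\<lambda>s i. if i = 0 then cos (\<theta> s) else sin (\<theta> s)"]
      by (auto simp: numeral_2_eq_2)
    show "e \<in> topspace (top_of_set {p..q}) \<rightarrow> {x. (\<Sum>i\<le>1. (x i)\<^sup>2) = 1}"
      by (auto simp: e_def)
  qed
  have surj: "e ` {p..q} = topspace (nsphere 1)"
  proof
    show "e ` {p..q} \<subseteq> topspace (nsphere 1)"
      using continuous_map_image_subset_topspace[OF cont] by auto
    show "topspace (nsphere 1) \<subseteq> e ` {p..q}"
    proof
      fix x assume "x \<in> topspace (nsphere 1)"
      then have x: "(x 0)\<^sup>2 + (x 1)\<^sup>2 = 1" "\<And>i. i \<ge> 2 \<Longrightarrow> x i = 0" unfolding top by auto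
      obtain u where u: "0 \<le> u" "u < 2 * pi" "x 0 = cos u" "x 1 = sin u"
        using sincos_total_2pi[OF x(1)] by blast
      define s where "s = p + (q - p) * (u / (2 * pi))"
      have "\<theta> s = u" using \<open>p < q\<close> by (simp add: \<theta>_def s_def)
      then have "x = e s"
        using u x(2) by (auto simp: e_def fun_eq_iff less_2_cases_iff)
      moreover have "0 \<le> u / (2 * pi)" "u / (2 * pi) \<le> 1" using u by auto
      then have "0 \<le> (q - p) * (u / (2 * pi))" "(q - p) * (u / (2 * pi)) \<le> (q - p) * 1"
        using \<open>p < q\<close> by (intro mult_nonneg_nonneg mult_left_mono; simp)+
      then have "s \<in> {p..q}" by (simp add: s_def)
      ultimately show "x \<in> e ` {p..q}" by blast
    qed
  qed
  have e_eq: "x = y \<or> (x = p \<and> y = q) \<or> (x = q \<and> y = p)"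
    if xy: "x \<in> {p..q}" "y \<in> {p..q}" "e x = e y" for x y
  proof -
    have "cos (\<theta> x) = cos (\<theta> y)" "sin (\<theta> x) = sin (\<theta> y)"
      using fun_cong[OF xy(3), of 0] fun_cong[OF xy(3), of 1] by (auto simp: e_def)
    then obtain n :: int where n: "\<theta> x = \<theta> y + 2 * pi * n" using sin_cos_eq_iff by blast
    have "(x - p) / (q - p) = (y - p) / (q - p) + n"
    proof -
      have "2 * pi * ((x - p) / (q - p)) = 2 * pi * ((y - p) / (q - p) + n)"
        using n unfolding \<theta>_def by (simp add: algebra_simps)
      then show ?thesis by (rule mult_left_cancel[THEN iffD1, rotated]) simp
    qed
    \<comment> \<open>The angles differ by \<open>n\<close> full turns, so the parameters differ by
      \<open>n\<close> lengths of the interval; within \<open>{p..q}\<close> this leaves only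
      \<open>n\<close> equal to 0, 1 or -1.\<close>
    then have eq: "x - y = n * (q - p)"
      using \<open>p < q\<close> by (simp add: field_simps)
    have "\<bar>x - y\<bar> \<le> q - p" using xy by auto
    then have "\<bar>real_of_int n\<bar> * (q - p) \<le> 1 * (q - p)" using eq \<open>p < q\<close> by (simp add: abs_mult)
    then have "\<bar>real_of_int n\<bar> \<le> 1" using \<open>p < q\<close> by (simp add: mult_le_cancel_right)
    then have "n = 0 \<or> n = 1 \<or> n = -1" by linarith
    then show ?thesis using eq xy(1,2) by auto
  qed
  have "quotient_map (top_of_set {p..q}) (nsphere 1) e"
  proof (rule continuous_imp_quotient_map[OF cont])
    show "Hausdorff_space (nsphere 1)"
      unfolding nsphere_def using Hausdorff_Euclidean_space Hausdorff_space_subtopology by blast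
  qed (auto simp: compact_space_subtopology surj)
  then obtain G where G: "continuous_map (nsphere 1) Y G"
      "G ` topspace (nsphere 1) = \<gamma> ` topspace (top_of_set {p..q})"
      "\<And>x. x \<in> topspace (top_of_set {p..q}) \<Longrightarrow> G (e x) = \<gamma> x"
    by (rule quotient_map_lift_exists[OF _ \<gamma>(1)]) (use e_eq \<gamma>(2) in \<open>auto, metis\<close>)
  have "\<theta> p = 0" "\<theta> q = 2 * pi" using \<open>p < q\<close> by (simp_all add: \<theta>_def)
  then have eqp: "e p = e q" by (auto simp: e_def fun_eq_iff)
  have "compactin (nsphere 1) (e ` {p..q})"
    by (rule image_compactin[OF _ cont]) (simp add: compactin_subtopology)
  then have cpt: "compact_space (nsphere 1)" by (simp add: surj compact_space_def)
  have "inj_on G (topspace (nsphere 1))"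
  proof (rule inj_onI)
    fix u v assume uv: "u \<in> topspace (nsphere 1)" "v \<in> topspace (nsphere 1)" and eq: "G u = G v"
    \<comment> \<open>The half-open interval already covers the circle, because \<open>e\<close>
      agrees at \<open>p\<close> and \<open>q\<close>; on it \<open>\<gamma>\<close> is
      injective.\<close>
    have "{p..q} = insert q {p..<q}" "p \<in> {p..<q}" using \<open>p < q\<close> by auto
    then have "e ` {p..q} \<subseteq> e ` {p..<q}" using eqp by (metis image_eqI image_insert insert_subset subset_refl)
    then have "u \<in> e ` {p..<q}" "v \<in> e ` {p..<q}" using uv surj by auto
    then obtain x y where "x \<in> {p..<q}" "y \<in> {p..<q}" "u = e x" "v = e y" by blast
    moreover from this have "\<gamma> x = \<gamma> y" using eq G(3)[of x] G(3)[of y] by auto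
    ultimately show "u = v" using inj_onD[OF \<gamma>(3)] by blast
  qed
  then have "homeomorphic_map (nsphere 1) Y G"
    using G(1,2) \<gamma>(4) Haus cpt by (intro continuous_imp_homeomorphic_map) auto
  then show ?thesis
    using homeomorphic_map_imp_homeomorphic_space homeomorphic_space_sym by blast
qed

theorem compact_connected_1_manifold_is_circle:
  assumes Haus: "Hausdorff_space Y" and cpt: "compact_space Y" and conn: "connected_space Y"
    and ne: "topspace Y \<noteq> {}" and arcs: "\<And>p. p \<in> topspace Y \<Longrightarrow> \<exists>g. open_arc Y g \<and> p \<in> range g"
  shows "Y homeomorphic_space nsphere 1"
proof -
  define cover where "cover G \<longleftrightarrow> finite G \<and> (\<forall>g\<in>G. open_arc Y g) \<and> \<Union>(range ` G) = topspace Y" for G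
  have range_sub: "range g \<subseteq> topspace Y" if "open_arc Y g" for g
    using open_arc_openin_range[OF that] openin_subset by blast
  have "\<exists>G. cover G"
  proof -
    have "\<exists>F. finite F \<and> F \<subseteq> range ` Collect (open_arc Y) \<and> topspace Y \<subseteq> \<Union>F"
      using cpt unfolding compact_space_def
      by (rule compactinD) (use arcs in \<open>auto simp: open_arc_openin_range\<close>)
    then obtain F where "finite F" "F \<subseteq> range ` Collect (open_arc Y)" "topspace Y \<subseteq> \<Union>F" by blast
    then obtain G where "finite G" "G \<subseteq> Collect (open_arc Y)" "F = range ` G"
      using finite_subset_image by metis
    then have "cover G" unfolding cover_def using \<open>topspace Y \<subseteq> \<Union>F\<close> range_sub by fastforce
    then show ?thesis by blast
  qed
  then obtain G where G: "cover G" and min: "\<And>G'. cover G' \<Longrightarrow> card G \<le> card G'"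
    using ex_has_least_nat[of cover _ card] by metis
  have fin: "finite G" and Garc: "\<And>g. g \<in> G \<Longrightarrow> open_arc Y g" and un: "\<Union>(range ` G) = topspace Y"
    using G by (auto simp: cover_def)
  obtain g1 where g1: "g1 \<in> G" using un ne by blast
  \<comment> \<open>A single arc cannot be everything: the line is not compact.\<close>
  have not_all: "range g1 \<noteq> topspace Y"
  proof
    assume eq: "range g1 = topspace Y"
    have "homeomorphic_map euclideanreal Y g1"
      using Garc[OF g1] eq by (intro bijective_open_imp_homeomorphic_map) (auto simp: open_arc_def)
    then have "compact_space euclideanreal"
      using cpt homeomorphic_compact_space homeomorphic_map_imp_homeomorphic_space by blast
    then show False
      by (simp add: compact_space_def not_compact_UNIV)
  qed
  \<comment> \<open>Otherwise \<open>range g1\<close> and the union of the remaining arcs would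
    disconnect the space.\<close>
  have disj: "\<exists>g2\<in>G - {g1}. range g1 \<inter> range g2 \<noteq> {}"
  proof (rule ccontr)
    assume "\<not> ?thesis"
    then have "range g1 \<inter> \<Union>(range ` (G - {g1})) = {}" by blast
    moreover have "range g1 \<union> \<Union>(range ` (G - {g1})) = topspace Y" using un g1 by blast
    moreover have "openin Y (range g1)" "openin Y (\<Union>(range ` (G - {g1})))"
      using Garc g1 open_arc_openin_range by (auto intro!: openin_Union)
    ultimately show False
      using conn not_all unfolding connected_space_def by (metis Un_empty_right order_refl rangeI empty_iff)
  qed
  then obtain g2 where g2: "g2 \<in> G" "g2 \<noteq> g1" "range g1 \<inter> range g2 \<noteq> {}" by blast
  \<comment> \<open>An arc inside another one could be dropped from the cover, against minimality.
    This supplies the two non-inclusion hypotheses of \<open>open_arcs_merge\<close>.\<close>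
  have drop: "\<not> range a \<subseteq> range b" if "a \<in> G" "b \<in> G" "a \<noteq> b" for a b
  proof
    assume "range a \<subseteq> range b"
    then have "\<Union>(range ` G) = \<Union>(range ` (G - {a}))" using that by blast
    then have "cover (G - {a})" using G unfolding cover_def by auto
    then show False using min fin that(1) by (meson card_Diff1_less leD)
  qed
  show ?thesis
  proof (rule open_arcs_merge[OF Haus Garc[OF g1] Garc[OF g2(1)] g2(3) drop drop])
    fix h assume h: "open_arc Y h" "range h = range g1 \<union> range g2"
    have "\<Union>(range ` insert h (G - {g1, g2})) = range g1 \<union> range g2 \<union> \<Union>(range ` (G - {g1, g2}))"
      by (simp add: h(2))
    also have "\<dots> = \<Union>(range ` insert g1 (insert g2 (G - {g1, g2})))" by (simp add: Un_assoc)
    also have "insert g1 (insert g2 (G - {g1, g2})) = G" using g1 g2 by blast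
    finally have "cover (insert h (G - {g1, g2}))"
      using G h(1) unfolding cover_def by auto
    \<comment> \<open>The subtraction \<open>card G - 2\<close> is truncated, so the strict
      inequality also needs that \<open>G\<close> has at least the two members \<open>g1\<close> and
      \<open>g2\<close>.\<close>
    moreover have "card (insert h (G - {g1, g2})) < card G"
    proof -
      have "card (insert h (G - {g1, g2})) \<le> Suc (card (G - {g1, g2}))" using fin by (simp add: card_insert_if)
      moreover have "card (G - {g1, g2}) = card G - 2"
        using fin g1 g2 by (subst card_Diff_subset) auto
      moreover have "card {g1, g2} \<le> card G" using fin g1 g2 by (intro card_mono) auto
      ultimately show ?thesis using g2 by auto
    qed
    ultimately show ?thesis using min by (meson leD)
  next
    fix \<gamma> :: "real \<Rightarrow> 'a" and p q :: real
    assume \<gamma>: "p < q" "continuous_map (top_of_set {p..q}) Y \<gamma>" "\<gamma> p = \<gamma> q"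
        "inj_on \<gamma> {p..<q}" "\<gamma> ` {p..q} = range g1 \<union> range g2"
    have "compactin Y (\<gamma> ` {p..q})"
      by (rule image_compactin[OF _ \<gamma>(2)]) (simp add: compactin_subtopology)
    then have "closedin Y (range g1 \<union> range g2)"
      using Haus compactin_imp_closedin \<gamma>(5) by metis
    moreover have "openin Y (range g1 \<union> range g2)"
      using Garc g1 g2 open_arc_openin_range by blast
    ultimately have "range g1 \<union> range g2 = topspace Y"
      using conn unfolding connected_space_clopen_in by blast
    then show ?thesis
      using closed_curve_homeomorphic_circle[OF \<gamma>(1-4) _ Haus] \<gamma>(5) by simp
  qed (use g1 g2 in auto)
qed

section \<open>Boxes in foliated charts\<close>

text \<open>Bridge from abstract topologies to the type-class topology on
  \<open>nat \<Rightarrow> real\<close>, in which continuity and openness are easy to check.\<close>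

lemma Euclidean_space_eq_top_of_set: "Euclidean_space k = top_of_set (topspace (Euclidean_space k))"
  by (simp add: Euclidean_space_def euclidean_product_topology)

lemma subtopology_Euclidean_space:
  assumes "D \<subseteq> topspace (Euclidean_space k)"
  shows "subtopology (Euclidean_space k) D = top_of_set D"
  using assms by (metis Euclidean_space_eq_top_of_set inf.absorb_iff2 subtopology_subtopology)

lemma topspace_model_space:
  "topspace (model_space k l) = topspace (Euclidean_space k) \<times> topspace (Euclidean_space l)"
  by (simp add: model_space_def)

lemma subtopology_model_space_Times:
  "subtopology (model_space k l) (D \<times> E) = prod_topology (subtopology (Euclidean_space k) D) (subtopology (Euclidean_space l) E)"
  by (simp add: model_space_def subtopology_Times)

lemma disc_subset: "disc k \<subseteq> topspace (Euclidean_space k)"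
  by (auto simp: disc_def)

lemma zero_in_disc: "(\<lambda>i. 0) \<in> disc k"
  by (simp add: disc_def topspace_Euclidean_space)

lemma disc_coordinate_less_1:
  assumes "x \<in> disc k" shows "\<bar>x i\<bar> < 1"
proof (cases "i < k")
  case True
  then have "(x i)\<^sup>2 \<le> (\<Sum>i<k. (x i)\<^sup>2)" by (intro member_le_sum) auto
  also have "\<dots> < 1" using assms by (simp add: disc_def)
  finally show ?thesis by (simp add: abs_square_less_1)
next
  case False
  then show ?thesis using assms by (simp add: disc_def topspace_Euclidean_space)
qed

lemma continuous_on_coordinate [continuous_intros]:
  "continuous_on S (\<lambda>x. x i :: 'b::topological_space)"
  by (rule continuous_on_product_then_coordinatewise[OF continuous_on_id])

lemma openin_disc: "openin (Euclidean_space k) (disc k)"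
proof -
  have "open {x::nat\<Rightarrow>real. (\<Sum>i<k. (x i)\<^sup>2) < 1}"
    by (intro open_Collect_less continuous_intros)
  moreover have "disc k = topspace (Euclidean_space k) \<inter> {x. (\<Sum>i<k. (x i)\<^sup>2) < 1}"
    by (auto simp: disc_def)
  ultimately show ?thesis
    using Euclidean_space_eq_top_of_set openin_open by metis
qed

lemma disc_homeomorphic_Euclidean_space:
  "subtopology (Euclidean_space k) (disc k) homeomorphic_space Euclidean_space k"
proof -
  define N :: "(nat \<Rightarrow> real) \<Rightarrow> real" where "N x = (\<Sum>i<k. (x i)\<^sup>2)" for x
  have N0: "N x \<ge> 0" for x by (simp add: N_def sum_nonneg)
  have Nsc: "N (\<lambda>i. x i / c) = N x / c\<^sup>2" for x c
    by (simp add: N_def power_divide sum_divide_distrib)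
  \<comment> \<open>Radial stretching and its inverse. They match because
    \<open>1 + N (f x) = 1 / (1 - N x)\<close> and \<open>1 - N (g x) = 1 / (1 + N x)\<close>, where
    \<open>N\<close> is the squared norm.\<close>
  define f where "f x = (\<lambda>i. x i / sqrt (1 - N x))" for x :: "nat \<Rightarrow> real"
  define g where "g x = (\<lambda>i. x i / sqrt (1 + N x))" for x :: "nat \<Rightarrow> real"
  let ?E = "topspace (Euclidean_space k)"
  have N1: "N x < 1" if "x \<in> disc k" for x using that by (simp add: disc_def N_def)
  have contN: "continuous_on S N" for S
    unfolding N_def by (intro continuous_intros)
  have cf: "continuous_on (disc k) f"
    unfolding f_def by (intro continuous_intros contN) (use N1 in force)
  have cg: "continuous_on ?E g"
    unfolding g_def by (intro continuous_intros contN) (metis N0 add_pos_nonneg less_irrefl real_sqrt_eq_zero_cancel_iff zero_less_one)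
  have fE: "f ` disc k \<subseteq> ?E"
    by (auto simp: f_def disc_def topspace_Euclidean_space)
  have gD: "g ` ?E \<subseteq> disc k"
  proof clarify
    fix x assume x: "x \<in> ?E"
    have "N (g x) = N x / (1 + N x)"
      unfolding g_def Nsc using N0[of x] by simp
    also have "\<dots> < 1" using N0[of x] by (simp add: field_simps)
    finally show "g x \<in> disc k"
      using x by (auto simp: disc_def N_def g_def topspace_Euclidean_space)
  qed
  have gf: "g (f x) = x" if "x \<in> disc k" for x
  proof -
    have "N (f x) = N x / (1 - N x)" unfolding f_def Nsc using N1[OF that] by simp
    then have "1 + N (f x) = 1 / (1 - N x)" using N1[OF that] by (simp add: field_simps)
    then show ?thesis using N1[OF that] by (simp add: g_def f_def real_sqrt_divide)
  qed
  have fg: "f (g x) = x" for x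
  proof -
    have "N (g x) = N x / (1 + N x)" unfolding g_def Nsc using N0[of x] by simp
    then have "1 - N (g x) = 1 / (1 + N x)" using N0[of x] by (simp add: field_simps)
    then show ?thesis using N0[of x] by (simp add: g_def f_def real_sqrt_divide)
  qed
  have "homeomorphic_maps (top_of_set (disc k)) (top_of_set ?E) f g"
    unfolding homeomorphic_maps_def using cf cg fE gD gf fg by auto
  then show ?thesis
    unfolding homeomorphic_space_def subtopology_Euclidean_space[OF disc_subset]
    using Euclidean_space_eq_top_of_set by metis
qed

lemma connected_space_disc: "connected_space (subtopology (Euclidean_space k) (disc k))"
  using connected_Euclidean_space disc_homeomorphic_Euclidean_space homeomorphic_connected_space by blast

text \<open>A basic open set of the product constrains only finitely many coordinates, so one radius
  serves all of them although the index set may be infinite.\<close>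

lemma open_fun_contains_cube:
  fixes G :: "('i \<Rightarrow> real) set"
  assumes "open G" "a \<in> G"
  obtains e where "e > 0" "\<And>x. (\<And>i. \<bar>x i\<bar> \<le> e) \<Longrightarrow> (\<lambda>i. a i + x i) \<in> G"
proof -
  have "openin (product_topology (\<lambda>i. euclidean) UNIV) G"
    using assms(1) open_fun_def by blast
  from product_topology_open_contains_basis[OF this assms(2)]
  obtain V where V: "a \<in> Pi\<^sub>E UNIV V" "\<And>i. open (V i)" "finite {i. V i \<noteq> UNIV}" "Pi\<^sub>E UNIV V \<subseteq> G"
    by auto
  have "\<exists>d>0. \<forall>y. \<bar>y\<bar> \<le> d \<longrightarrow> a i + y \<in> V i" for i
  proof -
    have "a i \<in> V i" using V(1) by auto
    then obtain d where "d > 0" "cball (a i) d \<subseteq> V i"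
      using V(2) open_contains_cball by blast
    then show ?thesis by (intro exI[of _ d]) (auto simp: subset_iff dist_real_def)
  qed
  then obtain d where d: "\<And>i. d i > 0" "\<And>i y. \<bar>y\<bar> \<le> d i \<Longrightarrow> a i + y \<in> V i" by metis
  \<comment> \<open>Inserting 1 keeps the minimum meaningful when no coordinate is
    constrained.\<close>
  define e where "e = Min (insert 1 (d ` {i. V i \<noteq> UNIV}))"
  have "e > 0" unfolding e_def using V(3) d(1) by auto
  moreover have "(\<lambda>i. a i + x i) \<in> G" if x: "\<And>i. \<bar>x i\<bar> \<le> e" for x
  proof -
    have "a i + x i \<in> V i" for i
    proof (cases "V i = UNIV")
      case False
      then have "e \<le> d i" unfolding e_def using V(3) by (intro Min_le) auto
      then show ?thesis using d(2) x order_trans by blast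
    qed auto
    then show ?thesis using V(4) by auto
  qed
  ultimately show thesis using that by blast
qed

lemma openin_model_space_contains_box:
  assumes "openin (model_space k l) G" "(a, b) \<in> G"
  obtains r where "r > 0"
    "\<And>x y. x \<in> disc k \<Longrightarrow> y \<in> disc l \<Longrightarrow> ((\<lambda>i. a i + r * x i), (\<lambda>i. b i + r * y i)) \<in> G"
proof -
  obtain G1 G2 where G: "openin (Euclidean_space k) G1" "openin (Euclidean_space l) G2"
      "a \<in> G1" "b \<in> G2" "G1 \<times> G2 \<subseteq> G"
    using assms(1)[unfolded model_space_def openin_prod_topology_alt, rule_format, OF assms(2)] by blast
  have *: "\<exists>e>0. \<forall>x. (\<forall>i. \<bar>x i\<bar> \<le> e) \<and> x \<in> topspace (Euclidean_space k) \<longrightarrow> (\<lambda>i. a i + x i) \<in> G"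
    if G: "openin (Euclidean_space k) G" "a \<in> G" for k G a
  proof -
    obtain H where H: "open H" "G = topspace (Euclidean_space k) \<inter> H"
      using G(1) Euclidean_space_eq_top_of_set openin_open by metis
    obtain e where e: "e > 0" "\<And>x. (\<And>i. \<bar>x i\<bar> \<le> e) \<Longrightarrow> (\<lambda>i. a i + x i) \<in> H"
      using open_fun_contains_cube[OF H(1), of a] G(2) H(2) by blast
    show ?thesis
      using e H(2) G(2) by (intro exI[of _ e]) (auto simp: topspace_Euclidean_space)
  qed
  obtain e1 where e1: "e1 > 0" "\<And>x. (\<And>i. \<bar>x i\<bar> \<le> e1) \<Longrightarrow> x \<in> topspace (Euclidean_space k) \<Longrightarrow> (\<lambda>i. a i + x i) \<in> G1"
    using *[OF G(1,3)] by blast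
  obtain e2 where e2: "e2 > 0" "\<And>x. (\<And>i. \<bar>x i\<bar> \<le> e2) \<Longrightarrow> x \<in> topspace (Euclidean_space l) \<Longrightarrow> (\<lambda>i. b i + x i) \<in> G2"
    using *[OF G(2,4)] by blast
  define r where "r = min e1 e2"
  have r: "r > 0" "r \<le> e1" "r \<le> e2" using e1 e2 by (auto simp: r_def)
  show thesis
  proof (rule that[OF r(1)])
    fix x y assume xy: "x \<in> disc k" "y \<in> disc l"
    have bd: "\<bar>r * z i\<bar> \<le> r" if "z \<in> disc m" for z m i
      using disc_coordinate_less_1[OF that, of i] r(1) by (simp add: abs_mult mult_left_le)
    have "(\<lambda>i. a i + r * x i) \<in> G1"
      using bd[OF xy(1)] r xy(1) by (intro e1(2)) (auto simp: disc_def topspace_Euclidean_space intro: order_trans)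
    moreover have "(\<lambda>i. b i + r * y i) \<in> G2"
      using bd[OF xy(2)] r xy(2) by (intro e2(2)) (auto simp: disc_def topspace_Euclidean_space intro: order_trans)
    ultimately show "((\<lambda>i. a i + r * x i), (\<lambda>i. b i + r * y i)) \<in> G" using G(5) by blast
  qed
qed

lemma homeomorphic_map_affine_Euclidean_space:
  assumes "r > 0" "a \<in> topspace (Euclidean_space k)"
  shows "homeomorphic_maps (Euclidean_space k) (Euclidean_space k) (\<lambda>x i. (x i - a i) / r) (\<lambda>x i. a i + r * x i)"
proof -
  have "continuous_on (topspace (Euclidean_space k)) (\<lambda>x i. (x i - a i) / r)"
       "continuous_on (topspace (Euclidean_space k)) (\<lambda>x i. a i + r * x i)"
    using assms(1) by (intro continuous_intros; simp)+
  then have "continuous_map (Euclidean_space k) (Euclidean_space k) (\<lambda>x i. (x i - a i) / r)"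
       "continuous_map (Euclidean_space k) (Euclidean_space k) (\<lambda>x i. a i + r * x i)"
    using cm_Euclidean_space_iff_continuous_on[of k UNIV k] assms(2) by (auto simp: topspace_Euclidean_space)
  then show ?thesis
    using assms by (auto simp: homeomorphic_maps_def)
qed

text \<open>Around \<open>\<phi> p\<close> the chart image contains a small product box; rescaling
  it to \<open>disc k \<times> disc l\<close> treats the two factors separately and injectively, so
  the plaques of the new chart are those of \<open>\<phi>\<close>.\<close>

proposition chart_contains_box:
  assumes c: "is_chart X k l (U, \<phi>)" and p: "p \<in> U" "openin X V" "p \<in> V"
  obtains W \<psi> where "p \<in> W" "W \<subseteq> U \<inter> V" "openin X W"
    "homeomorphic_map (subtopology X W) (subtopology (model_space k l) (disc k \<times> disc l)) \<psi>"
    "\<And>z w. snd (\<psi> z) = snd (\<psi> w) \<longleftrightarrow> snd (\<phi> z) = snd (\<phi> w)"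
proof -
  have U: "openin X U" "openin (model_space k l) (\<phi> ` U)"
    and hom: "homeomorphic_map (subtopology X U) (subtopology (model_space k l) (\<phi> ` U)) \<phi>"
    using c by (auto simp: is_chart_def)
  have UX: "U \<subseteq> topspace X" using U(1) openin_subset by blast
  have img_sub: "\<phi> ` U \<subseteq> topspace (model_space k l)" using U(2) openin_subset by blast
  have inj: "inj_on \<phi> U"
    using homeomorphic_imp_injective_map[OF hom] UX by (simp add: Int_absorb1)
  have "openin (subtopology X U) (U \<inter> V)" using p(2) openin_subtopology_Int2 by blast
  then have "openin (subtopology (model_space k l) (\<phi> ` U)) (\<phi> ` (U \<inter> V))"
    using homeomorphic_imp_open_map[OF hom] by (simp add: open_map_def)
  then have op: "openin (model_space k l) (\<phi> ` (U \<inter> V))"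
    using U(2) openin_trans_full by blast
  obtain a b where ab: "\<phi> p = (a, b)" by fastforce
  have mem: "(a, b) \<in> \<phi> ` (U \<inter> V)" using p ab by (metis IntI image_eqI)
  then have aE: "a \<in> topspace (Euclidean_space k)" and bE: "b \<in> topspace (Euclidean_space l)"
    using img_sub by (auto simp: topspace_model_space)
  obtain r where r: "r > 0"
    "\<And>x y. x \<in> disc k \<Longrightarrow> y \<in> disc l \<Longrightarrow> ((\<lambda>i. a i + r * x i), (\<lambda>i. b i + r * y i)) \<in> \<phi> ` (U \<inter> V)"
    using openin_model_space_contains_box[OF op mem] by blast
  define m where "m = (\<lambda>(x, y). ((\<lambda>i. (x i - a i) / r), (\<lambda>i. (y i - b i) / r)))"
  define m' where "m' = (\<lambda>(x, y). ((\<lambda>i. a i + r * x i), (\<lambda>i. b i + r * y i)))"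
  have hm: "homeomorphic_maps (model_space k l) (model_space k l) m m'"
    unfolding m_def m'_def model_space_def homeomorphic_maps_prod
    using homeomorphic_map_affine_Euclidean_space[OF r(1)] aE bE by simp
  define \<psi> where "\<psi> = m \<circ> \<phi>"
  let ?B = "disc k \<times> disc l"
  have BE: "?B \<subseteq> topspace (model_space k l)" using disc_subset by (auto simp: topspace_model_space)
  define W where "W = {z \<in> U. \<psi> z \<in> ?B}"
  have m'm: "m' (m u) = u" "m (m' u) = u" for u
    using r(1) by (auto simp: m_def m'_def split: prod.split)
  have m'B: "m' ` ?B \<subseteq> \<phi> ` (U \<inter> V)" using r(2) by (auto simp: m'_def)
  have phiW: "\<phi> ` W = m' ` ?B"
  proof
    show "\<phi> ` W \<subseteq> m' ` ?B"
      by (auto simp: W_def \<psi>_def) (metis SigmaI image_eqI m'm(1))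
    show "m' ` ?B \<subseteq> \<phi> ` W"
    proof
      fix u assume "u \<in> m' ` ?B"
      then obtain v where v: "v \<in> ?B" "u = m' v" by blast
      then obtain z where z: "z \<in> U" "u = \<phi> z" using m'B by blast
      then have "\<psi> z = v" using v m'm(2)[of v] by (simp add: \<psi>_def)
      then show "u \<in> \<phi> ` W" using z v by (auto simp: W_def)
    qed
  qed
  have WUV: "W \<subseteq> U \<inter> V"
  proof
    fix z assume z: "z \<in> W"
    then have "\<phi> z \<in> m' ` ?B" using phiW by blast
    then have "\<phi> z \<in> \<phi> ` (U \<inter> V)" "z \<in> U" using m'B z by (auto simp: W_def)
    then show "z \<in> U \<inter> V" using inj by (metis Int_iff imageE inj_onD)
  qed
  have hom1: "homeomorphic_map (subtopology X W) (subtopology (model_space k l) (\<phi> ` W)) \<phi>"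
  proof -
    have "homeomorphic_map (subtopology (subtopology X U) W) (subtopology (subtopology (model_space k l) (\<phi> ` U)) (\<phi> ` W)) \<phi>"
      by (rule homeomorphic_map_subtopologies[OF hom]) (use WUV UX img_sub in auto)
    moreover have "U \<inter> W = W" "\<phi> ` U \<inter> \<phi> ` W = \<phi> ` W" using WUV by auto
    ultimately show ?thesis by (simp add: subtopology_subtopology)
  qed
  have hom2: "homeomorphic_map (subtopology (model_space k l) (\<phi> ` W)) (subtopology (model_space k l) ?B) m"
  proof (rule homeomorphic_map_subtopologies)
    show "homeomorphic_map (model_space k l) (model_space k l) m" using hm homeomorphic_map_maps by blast
    have "topspace (model_space k l) \<inter> \<phi> ` W = \<phi> ` W" using img_sub WUV by blast
    then show "m ` (topspace (model_space k l) \<inter> \<phi> ` W) = topspace (model_space k l) \<inter> ?B"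
      using BE unfolding phiW by (auto simp: image_image m'm)
  qed
  show thesis
  proof (rule that)
    show "p \<in> W" using p(1) ab r(1) zero_in_disc by (simp add: W_def \<psi>_def m_def)
    show "W \<subseteq> U \<inter> V" by (rule WUV)
    show "homeomorphic_map (subtopology X W) (subtopology (model_space k l) ?B) \<psi>"
      unfolding \<psi>_def using hom1 hom2 by (rule homeomorphic_map_compose)
    \<comment> \<open>The rescaling is injective on all sequences, so the equivalence holds even for
      points outside the box. This spares side conditions later.\<close>
    show "snd (\<psi> z) = snd (\<psi> w) \<longleftrightarrow> snd (\<phi> z) = snd (\<phi> w)" for z w
      using r(1) by (auto simp: \<psi>_def m_def fun_eq_iff split: prod.split)
    have "openin (model_space k l) ?B"
      unfolding model_space_def using openin_disc by (simp add: openin_prod_Times_iff)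
    then have "openin (model_space k l) (m' ` ?B)"
      using hm homeomorphic_maps_sym homeomorphic_maps_map homeomorphic_map_openness_eq by metis
    then have "openin (model_space k l) (\<phi> ` W)" by (simp add: phiW)
    moreover have "\<phi> ` W \<subseteq> \<phi> ` U" using WUV by blast
    ultimately have "openin (subtopology (model_space k l) (\<phi> ` U)) (\<phi> ` W)"
      by (simp add: openin_subtopology_Int2 inf.absorb_iff2 openin_open_subtopology U(2))
    then have "openin (subtopology X U) W"
      using homeomorphic_map_openness[OF hom, of W] WUV UX by auto
    then show "openin X W" using U(1) openin_trans_full by blast
  qed
qed

text \<open>A box of the ambient manifold, open in \<open>X\<close> rather than in \<open>S\<close>,
  whose transversal factor is a whole disc. The last clause ties its plaques to a chart of
  \<open>A\<close>, through which leaves and transition maps are reached.\<close>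

definition flat_box :: "'a topology \<Rightarrow> nat \<Rightarrow> nat \<Rightarrow> 'a fchart set \<Rightarrow> 'a set
     \<Rightarrow> ('a \<Rightarrow> (nat \<Rightarrow> real) \<times> (nat \<Rightarrow> real)) \<Rightarrow> bool" where
  "flat_box X k l A W \<psi> \<longleftrightarrow> openin X W \<and>
     homeomorphic_map (subtopology X W) (subtopology (model_space k l) (disc k \<times> disc l)) \<psi> \<and>
     (\<exists>(U, \<phi>)\<in>A. W \<subseteq> U \<and> (\<forall>z w. snd (\<psi> z) = snd (\<psi> w) \<longleftrightarrow> snd (\<phi> z) = snd (\<phi> w)))"

lemma flat_box_in_chart:
  assumes "foliated_manifold X k l A" "(U, \<phi>) \<in> A" "p \<in> U" "openin X V" "p \<in> V"
  obtains W \<psi> where "flat_box X k l A W \<psi>" "p \<in> W" "W \<subseteq> U \<inter> V"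
    "\<And>z w. snd (\<psi> z) = snd (\<psi> w) \<longleftrightarrow> snd (\<phi> z) = snd (\<phi> w)"
proof -
  have "is_chart X k l (U, \<phi>)" using assms by (auto simp: foliated_manifold_def)
  from chart_contains_box[OF this assms(3-5)]
  obtain W \<psi> where "p \<in> W" "W \<subseteq> U \<inter> V" "openin X W"
    "homeomorphic_map (subtopology X W) (subtopology (model_space k l) (disc k \<times> disc l)) \<psi>"
    "\<And>z w. snd (\<psi> z) = snd (\<psi> w) \<longleftrightarrow> snd (\<phi> z) = snd (\<phi> w)" by blast
  then show thesis
    using assms(2) by (intro that[of W \<psi>]) (auto simp: flat_box_def)
qed

lemma flat_box_exists:
  assumes "foliated_manifold X k l A" "openin X V" "p \<in> V"
  obtains W \<psi> where "flat_box X k l A W \<psi>" "p \<in> W" "W \<subseteq> V"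
proof -
  have "p \<in> topspace X" using assms(2,3) openin_subset by blast
  then obtain U \<phi> where "(U, \<phi>) \<in> A" "p \<in> U"
    using assms(1) unfolding foliated_manifold_def by (metis (no_types) UN_E prod.collapse)
  from flat_box_in_chart[OF assms(1) this assms(2,3)] show thesis using that by (metis le_inf_iff)
qed

section \<open>Plaques of a flat box\<close>

context
  fixes X :: "'a topology" and k l :: nat and A :: "'a fchart set" and W \<psi>
  assumes fb: "flat_box X k l A W \<psi>"
begin

lemma flat_box_openin: "openin X W"
  and flat_box_homeomorphic_map:
    "homeomorphic_map (subtopology X W) (subtopology (model_space k l) (disc k \<times> disc l)) \<psi>"
  using fb by (auto simp: flat_box_def)

lemma flat_box_subset: "W \<subseteq> topspace X"
  using flat_box_openin openin_subset by blast

lemma flat_box_image: "\<psi> ` W = disc k \<times> disc l"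
proof -
  have "topspace (subtopology (model_space k l) (disc k \<times> disc l)) = disc k \<times> disc l"
    using disc_subset by (auto simp: topspace_model_space)
  then show ?thesis
    using homeomorphic_imp_surjective_map[OF flat_box_homeomorphic_map] flat_box_subset
    by (simp add: Int_absorb1)
qed

lemma flat_box_slice_homeomorphic:
  assumes "E \<subseteq> disc l"
  shows "homeomorphic_map (subtopology X {z\<in>W. snd (\<psi> z) \<in> E})
     (subtopology (model_space k l) (disc k \<times> E)) \<psi>"
proof -
  have "homeomorphic_map (subtopology (subtopology X W) {z\<in>W. snd (\<psi> z) \<in> E})
     (subtopology (subtopology (model_space k l) (disc k \<times> disc l)) (disc k \<times> E)) \<psi>"
  proof (rule homeomorphic_map_subtopologies[OF flat_box_homeomorphic_map])
    have "\<psi> ` {z\<in>W. snd (\<psi> z) \<in> E} = disc k \<times> E"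
    proof
      show "\<psi> ` {z\<in>W. snd (\<psi> z) \<in> E} \<subseteq> disc k \<times> E"
      proof (rule image_subsetI)
        fix z assume z: "z \<in> {z\<in>W. snd (\<psi> z) \<in> E}"
        then have "\<psi> z \<in> disc k \<times> disc l" using flat_box_image by blast
        then show "\<psi> z \<in> disc k \<times> E" using z by (simp add: mem_Times_iff)
      qed
      show "disc k \<times> E \<subseteq> \<psi> ` {z\<in>W. snd (\<psi> z) \<in> E}"
      proof
        fix u assume u: "u \<in> disc k \<times> E"
        then have "u \<in> \<psi> ` W" using flat_box_image assms by auto
        then obtain z where "z \<in> W" "u = \<psi> z" by blast
        then show "u \<in> \<psi> ` {z\<in>W. snd (\<psi> z) \<in> E}" using u by (simp add: mem_Times_iff)
      qed
    qed
    moreover have "topspace (subtopology X W) \<inter> {z\<in>W. snd (\<psi> z) \<in> E} = {z\<in>W. snd (\<psi> z) \<in> E}"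
      using flat_box_subset by auto
    moreover have "topspace (subtopology (model_space k l) (disc k \<times> disc l)) \<inter> disc k \<times> E = disc k \<times> E"
      using disc_subset assms by (auto simp: topspace_model_space)
    ultimately show "\<psi> ` (topspace (subtopology X W) \<inter> {z\<in>W. snd (\<psi> z) \<in> E})
      = topspace (subtopology (model_space k l) (disc k \<times> disc l)) \<inter> disc k \<times> E" by simp
  qed
  moreover have "W \<inter> {z\<in>W. snd (\<psi> z) \<in> E} = {z\<in>W. snd (\<psi> z) \<in> E}"
      "(disc k \<times> disc l) \<inter> (disc k \<times> E) = disc k \<times> E" using assms by auto
  ultimately show ?thesis by (simp add: subtopology_subtopology)
qed

lemma flat_box_plaque_homeomorphic:
  assumes "y \<in> disc l"
  shows "subtopology X {z\<in>W. snd (\<psi> z) = y} homeomorphic_space subtopology (Euclidean_space k) (disc k)"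
proof -
  have "subtopology X {z\<in>W. snd (\<psi> z) \<in> {y}} homeomorphic_space subtopology (model_space k l) (disc k \<times> {y})"
    using flat_box_slice_homeomorphic[of "{y}"] assms homeomorphic_map_imp_homeomorphic_space by blast
  moreover have "prod_topology (subtopology (Euclidean_space k) (disc k)) (subtopology (Euclidean_space l) {y})
      homeomorphic_space subtopology (Euclidean_space k) (disc k)"
    using homeomorphic_space_prod_topology_sing1[of y "Euclidean_space l"] assms disc_subset
    by (metis homeomorphic_space_sym subsetD)
  ultimately show ?thesis
    using homeomorphic_space_trans by (auto simp: subtopology_model_space_Times)
qed

lemma flat_box_snd_in_disc: "z \<in> W \<Longrightarrow> snd (\<psi> z) \<in> disc l"
  using flat_box_image by (metis SigmaE image_eqI snd_conv)

lemma flat_box_plaque_connectedin: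
  assumes "z \<in> W"
  shows "connectedin X {v\<in>W. snd (\<psi> v) = snd (\<psi> z)}"
proof -
  have "connected_space (subtopology X {v\<in>W. snd (\<psi> v) = snd (\<psi> z)})"
    using flat_box_plaque_homeomorphic[OF flat_box_snd_in_disc[OF assms]]
      connected_space_disc homeomorphic_connected_space by blast
  then show ?thesis
    using flat_box_subset by (auto simp: connectedin_def)
qed

lemma flat_box_plaque_rel:
  assumes "z \<in> W" "w \<in> W" "snd (\<psi> z) = snd (\<psi> w)"
  shows "plaque_rel X A z w"
proof -
  let ?C = "{v\<in>W. snd (\<psi> v) = snd (\<psi> z)}"
  have "connectedin X ?C" by (rule flat_box_plaque_connectedin[OF assms(1)])
  moreover obtain U \<phi> where U: "(U, \<phi>) \<in> A" "W \<subseteq> U"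
      "\<And>z w. snd (\<psi> z) = snd (\<psi> w) \<longleftrightarrow> snd (\<phi> z) = snd (\<phi> w)"
    using fb by (auto simp: flat_box_def)
  ultimately show ?thesis
    unfolding plaque_rel_def using assms
    by (intro bexI[OF _ U(1)]) (auto intro!: exI[of _ ?C])
qed

text \<open>The projection of the box to its transversal factor is open and continuous, and the
  saturation of \<open>N\<close> is the preimage of the image of \<open>N\<close>.\<close>

lemma flat_box_open_saturation:
  assumes "openin X N" "N \<subseteq> W"
  shows "openin X {v\<in>W. \<exists>n\<in>N. snd (\<psi> v) = snd (\<psi> n)}"
proof -
  let ?P = "subtopology (Euclidean_space k) (disc k)" and ?Q = "subtopology (Euclidean_space l) (disc l)"
  have hom: "homeomorphic_map (subtopology X W) (prod_topology ?P ?Q) \<psi>"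
    using flat_box_homeomorphic_map by (simp add: subtopology_model_space_Times)
  have cont: "continuous_map (subtopology X W) ?Q (snd \<circ> \<psi>)"
    using homeomorphic_imp_continuous_map[OF hom] continuous_map_snd by (rule continuous_map_compose)
  have "open_map (subtopology X W) ?Q (snd \<circ> \<psi>)"
    using homeomorphic_imp_open_map[OF hom] open_map_snd by (rule open_map_compose)
  moreover have "openin (subtopology X W) N"
    using assms flat_box_openin openin_open_subtopology by blast
  ultimately have "openin ?Q ((snd \<circ> \<psi>) ` N)" by (simp add: open_map_def)
  from openin_continuous_map_preimage[OF cont this]
  have "openin (subtopology X W) {v\<in>W. \<exists>n\<in>N. snd (\<psi> v) = snd (\<psi> n)}"
    using flat_box_subset by (simp add: image_iff Int_absorb1)
  then show ?thesis using flat_box_openin openin_trans_full by blast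
qed

end

section \<open>Consequences of minimality\<close>

lemma saturated_iff_plaque_rel:
  "saturated X A Z \<longleftrightarrow> (\<forall>p q. p \<in> Z \<longrightarrow> plaque_rel X A p q \<longrightarrow> q \<in> Z)"
proof
  assume "saturated X A Z"
  then show "\<forall>p q. p \<in> Z \<longrightarrow> plaque_rel X A p q \<longrightarrow> q \<in> Z"
    by (auto simp: saturated_def leaf_def same_leaf_def)
next
  assume *: "\<forall>p q. p \<in> Z \<longrightarrow> plaque_rel X A p q \<longrightarrow> q \<in> Z"
  have "q \<in> Z" if "p \<in> Z" "(plaque_rel X A)\<^sup>*\<^sup>* p q" for p q
    using that(2,1) by (induction) (use * in auto)
  then show "saturated X A Z" by (auto simp: saturated_def leaf_def same_leaf_def)
qed

text \<open>A local form of saturation. Only the discs in flat boxes are tested, whereas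
  \<open>plaque_rel\<close> admits any connected set on which the transversal coordinate of a chart
  is constant, and such a set need not fit into one box.\<close>

definition plaque_closed :: "'a topology \<Rightarrow> nat \<Rightarrow> nat \<Rightarrow> 'a fchart set \<Rightarrow> 'a set \<Rightarrow> bool" where
  "plaque_closed X k l A Q \<longleftrightarrow> (\<forall>W \<psi> z w. flat_box X k l A W \<psi> \<longrightarrow> z \<in> W \<longrightarrow> w \<in> W \<longrightarrow>
      snd (\<psi> z) = snd (\<psi> w) \<longrightarrow> z \<in> Q \<longrightarrow> w \<in> Q)"

lemma plaque_closedD:
  "\<lbrakk>plaque_closed X k l A Q; flat_box X k l A W \<psi>; z \<in> W; w \<in> W; snd (\<psi> z) = snd (\<psi> w); z \<in> Q\<rbrakk> \<Longrightarrow> w \<in> Q"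
  unfolding plaque_closed_def by blast

text \<open>Along a connected set \<open>C\<close> inside a plaque, membership in \<open>Q\<close>
  is locally constant, since near each point \<open>C\<close> runs within one plaque of a flat box.
  By connectedness it is constant, so no plaque relation leads from \<open>S - Q\<close> into
  \<open>Q\<close>.\<close>

lemma saturated_Diff_plaque_closed:
  assumes fm: "foliated_manifold X k l A" and S: "saturated X A S" and Q: "plaque_closed X k l A Q"
  shows "saturated X A (S - Q)"
  unfolding saturated_iff_plaque_rel
proof (intro allI impI, rule ccontr)
  fix p q assume p: "p \<in> S - Q" and rel: "plaque_rel X A p q" and "q \<notin> S - Q"
  moreover have "q \<in> S" using S p rel saturated_iff_plaque_rel by fastforce
  ultimately have q: "q \<in> Q" by blast
  obtain U \<phi> C where C: "(U, \<phi>) \<in> A" "connectedin X C" "C \<subseteq> U" "p \<in> C" "q \<in> C"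
      "\<And>z. z \<in> C \<Longrightarrow> snd (\<phi> z) = snd (\<phi> p)"
    using rel unfolding plaque_rel_def by blast
  have "\<exists>W. openin X W \<and> z \<in> W \<and> (\<forall>w\<in>C \<inter> W. w \<in> Q \<longleftrightarrow> z \<in> Q)" if z: "z \<in> C" for z
  proof -
    have zX: "z \<in> topspace X" using z C(2) connectedin_subset_topspace by blast
    have zU: "z \<in> U" using z C(3) by blast
    obtain W \<psi> where W: "flat_box X k l A W \<psi>" "z \<in> W" and "W \<subseteq> U \<inter> topspace X" and W3:
      "\<And>z w. snd (\<psi> z) = snd (\<psi> w) \<longleftrightarrow> snd (\<phi> z) = snd (\<phi> w)"
      using flat_box_in_chart[OF fm C(1) zU openin_topspace zX] by blast
    have "w \<in> Q \<longleftrightarrow> z \<in> Q" if "w \<in> C \<inter> W" for w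
    proof -
      have "snd (\<psi> z) = snd (\<psi> w)" using W3 C(6) z that by auto
      then show ?thesis
        using plaque_closedD[OF Q W(1), of z w] plaque_closedD[OF Q W(1), of w z] W(2) that by auto
    qed
    then show ?thesis using W(2) flat_box_openin[OF W(1)] by blast
  qed
  then obtain W where W: "\<And>z. z \<in> C \<Longrightarrow> openin X (W z)" "\<And>z. z \<in> C \<Longrightarrow> z \<in> W z"
      "\<And>z w. z \<in> C \<Longrightarrow> w \<in> C \<inter> W z \<Longrightarrow> w \<in> Q \<longleftrightarrow> z \<in> Q" by metis
  \<comment> \<open>The boxes around points of \<open>Q\<close> and around points off
    \<open>Q\<close> would separate \<open>C\<close>.\<close>
  define E1 where "E1 = \<Union>(W ` (C \<inter> Q))"
  define E2 where "E2 = \<Union>(W ` (C - Q))"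
  have "openin X E1" "openin X E2" unfolding E1_def E2_def using W(1) by auto
  moreover have "C \<subseteq> E1 \<union> E2" unfolding E1_def E2_def using W(2) by auto
  moreover have "E1 \<inter> E2 \<inter> C = {}" unfolding E1_def E2_def using W(3) by blast
  moreover have "E1 \<inter> C \<noteq> {}" "E2 \<inter> C \<noteq> {}"
    unfolding E1_def E2_def using W(2) C(4,5) q p by auto
  ultimately show False
    using C(2) unfolding connectedin by blast
qed

lemma minimal_solenoid_plaque_closed:
  assumes "minimal_solenoid X k l A S" "openin (subtopology X S) Q" "plaque_closed X k l A Q" "Q \<noteq> {}"
  shows "Q = S"
proof -
  have S: "foliated_manifold X k l A" "compactin X S" "saturated X A S"
    using assms(1) by (auto simp: minimal_solenoid_def solenoid_def)
  have QS: "Q \<subseteq> S" using assms(2) openin_subset by fastforce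
  have "S \<subseteq> topspace X" using S(2) compactin_subset_topspace by blast
  then have top: "topspace (subtopology X S) = S" by (rule topspace_subtopology_subset)
  have "closedin (subtopology X S) (topspace (subtopology X S) - Q)"
    by (intro closedin_diff closedin_topspace assms(2))
  moreover have "compact_space (subtopology X S)" using S(2) by (simp add: compactin_subspace)
  ultimately have "compactin (subtopology X S) (S - Q)"
    unfolding top by (rule closedin_compact_space[rotated])
  then have "compactin X (S - Q)" by (simp add: compactin_subtopology)
  moreover have "saturated X A (S - Q)" by (rule saturated_Diff_plaque_closed[OF S(1,3) assms(3)])
  ultimately have "S - Q = {} \<or> S - Q = S"
    using assms(1) unfolding minimal_solenoid_def by blast
  then show ?thesis using QS assms(4) by blast
qed

lemma saturated_plaque_relD:
  assumes "saturated X A S" "plaque_rel X A z w" "z \<in> S"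
  shows "w \<in> S"
  using assms saturated_iff_plaque_rel by metis

text \<open>Sliding an open piece of \<open>S\<close> along the plaques of a box sweeps out an open
  set, and saturation keeps that set inside \<open>S\<close>.\<close>

lemma plaque_closed_interior:
  assumes S: "saturated X A S"
  shows "plaque_closed X k l A (X interior_of S)"
  unfolding plaque_closed_def
proof (intro allI impI)
  fix W \<psi> z w
  assume fb: "flat_box X k l A W \<psi>" and z: "z \<in> W" and w: "w \<in> W" and eq: "snd (\<psi> z) = snd (\<psi> w)"
    and zS: "z \<in> X interior_of S"
  define N where "N = W \<inter> X interior_of S"
  define M where "M = {v\<in>W. \<exists>n\<in>N. snd (\<psi> v) = snd (\<psi> n)}"
  have "openin X N" unfolding N_def using flat_box_openin[OF fb] by (intro openin_Int openin_interior_of)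
  then have "openin X M" unfolding M_def by (rule flat_box_open_saturation[OF fb]) (simp add: N_def)
  moreover have "M \<subseteq> S"
  proof
    fix v assume "v \<in> M"
    then obtain n where n: "v \<in> W" "n \<in> W" "n \<in> X interior_of S" "snd (\<psi> n) = snd (\<psi> v)"
      by (auto simp: M_def N_def)
    then have "n \<in> S" using interior_of_subset by fast
    then show "v \<in> S" using saturated_plaque_relD[OF S flat_box_plaque_rel[OF fb n(2,1,4)]] by blast
  qed
  ultimately have "M \<subseteq> X interior_of S" by (simp add: interior_of_maximal)
  moreover have "w \<in> M" using z w eq[symmetric] zS unfolding M_def N_def by blast
  ultimately show "w \<in> X interior_of S" by blast
qed

text \<open>The points near which \<open>S\<close> has no transversal extent. For a point of a
  transversal this amounts to being isolated in it, but the condition mentions no transversal, so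
  minimality can be applied to it.\<close>

definition plaque_interior :: "'a topology \<Rightarrow> 'a fchart set \<Rightarrow> 'a set \<Rightarrow> 'a set" where
  "plaque_interior X A S = {z\<in>S. \<exists>N U \<phi>. openin (subtopology X S) N \<and> z \<in> N \<and> (U, \<phi>) \<in> A \<and>
     N \<subseteq> U \<and> (\<forall>v\<in>N. snd (\<phi> v) = snd (\<phi> z))}"

lemma openin_plaque_interior: "openin (subtopology X S) (plaque_interior X A S)"
proof (subst openin_subopen, intro ballI)
  fix z assume "z \<in> plaque_interior X A S"
  then obtain N U \<phi> where N: "openin (subtopology X S) N" "z \<in> N" "(U, \<phi>) \<in> A" "N \<subseteq> U"
      "\<And>v. v \<in> N \<Longrightarrow> snd (\<phi> v) = snd (\<phi> z)"
    unfolding plaque_interior_def by blast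
  have NS: "N \<subseteq> S" using openin_subset[OF N(1)] by auto
  have "v \<in> plaque_interior X A S" if v: "v \<in> N" for v
    unfolding plaque_interior_def mem_Collect_eq
  proof (intro conjI exI)
    show "v \<in> S" using v NS by blast
    show "\<forall>u\<in>N. snd (\<phi> u) = snd (\<phi> v)" using N(5) v by metis
  qed (use N v in auto)
  then show "\<exists>T. openin (subtopology X S) T \<and> z \<in> T \<and> T \<subseteq> plaque_interior X A S"
    using N(1,2) by blast
qed

text \<open>A neighbourhood of \<open>z\<close> in which \<open>S\<close> is one plaque can be slid
  along the plaques of the box to a neighbourhood of \<open>w\<close>. The transition map turns
  constancy of the height in the old chart into constancy in the chart belonging to the box.\<close>

lemma plaque_closed_plaque_interior:
  assumes fm: "foliated_manifold X k l A" and S: "saturated X A S"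
  shows "plaque_closed X k l A (plaque_interior X A S)"
  unfolding plaque_closed_def
proof (intro allI impI)
  fix W \<psi> z w
  assume fb: "flat_box X k l A W \<psi>" and z: "z \<in> W" and w: "w \<in> W" and eq: "snd (\<psi> z) = snd (\<psi> w)"
    and zS: "z \<in> plaque_interior X A S"
  obtain U0 \<phi>0 where U0: "(U0, \<phi>0) \<in> A" "W \<subseteq> U0"
      "\<And>z w. snd (\<psi> z) = snd (\<psi> w) \<longleftrightarrow> snd (\<phi>0 z) = snd (\<phi>0 w)"
    using fb by (auto simp: flat_box_def)
  obtain N U \<phi> where N: "openin (subtopology X S) N" "z \<in> N" "(U, \<phi>) \<in> A" "N \<subseteq> U"
      "\<And>v. v \<in> N \<Longrightarrow> snd (\<phi> v) = snd (\<phi> z)" "z \<in> S"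
    using zS unfolding plaque_interior_def by blast
  obtain G where G: "openin X G" "N = G \<inter> S" using N(1) unfolding openin_subtopology by blast
  have trans: "foliated_transition (U, \<phi>) (U0, \<phi>0)"
    using fm N(3) U0(1) unfolding foliated_manifold_def by blast
  define M where "M = {v\<in>W. \<exists>n\<in>G \<inter> W. snd (\<psi> v) = snd (\<psi> n)}"
  have "openin X M" unfolding M_def
    by (rule flat_box_open_saturation[OF fb]) (use G(1) flat_box_openin[OF fb] in auto)
  then have op: "openin (subtopology X S) (S \<inter> M)" by (rule openin_subtopology_Int2)
  have "w \<in> S" by (rule saturated_plaque_relD[OF S flat_box_plaque_rel[OF fb z w eq] N(6)])
  moreover have "w \<in> M" using z w eq[symmetric] N(2) G(2) unfolding M_def by blast
  moreover have "snd (\<phi>0 v) = snd (\<phi>0 w)" if v: "v \<in> S \<inter> M" for v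
  proof -
    \<comment> \<open>Each point of \<open>S\<close> near \<open>w\<close> is slid back along its
      plaque to a point \<open>n\<close> near \<open>z\<close>; saturation puts \<open>n\<close>
      into \<open>S\<close>, hence into \<open>N\<close>.\<close>
    obtain n where n: "v \<in> W" "n \<in> G" "n \<in> W" "snd (\<psi> v) = snd (\<psi> n)" using v by (auto simp: M_def)
    have "n \<in> S" using saturated_plaque_relD[OF S flat_box_plaque_rel[OF fb n(1,3,4)]] v by blast
    then have nN: "n \<in> N" using n G by blast
    then have "snd (\<phi> n) = snd (\<phi> z)" "n \<in> U" "z \<in> U" using N(5)[OF nN] N(2,4) by auto
    then have "snd (\<phi>0 n) = snd (\<phi>0 z)"
      using trans n(3) z U0(2) unfolding foliated_transition_def by auto
    then show ?thesis using U0(3)[of v n] U0(3)[of z w] n(4) eq by simp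
  qed
  moreover have "S \<inter> M \<subseteq> U0" using U0(2) by (auto simp: M_def)
  ultimately show "w \<in> plaque_interior X A S"
    unfolding plaque_interior_def using op U0(1) by blast
qed

lemma plaque_interior_box:
  assumes fm: "foliated_manifold X k l A" and S: "saturated X A S" and z: "z \<in> plaque_interior X A S"
  obtains W \<psi> where "flat_box X k l A W \<psi>" "z \<in> W" "W \<inter> S = {v\<in>W. snd (\<psi> v) = snd (\<psi> z)}"
proof -
  obtain N U \<phi> where N: "openin (subtopology X S) N" "z \<in> N" "(U, \<phi>) \<in> A" "N \<subseteq> U"
      "\<And>v. v \<in> N \<Longrightarrow> snd (\<phi> v) = snd (\<phi> z)" "z \<in> S"
    using z unfolding plaque_interior_def by blast
  obtain G where G: "openin X G" "N = G \<inter> S" using N(1) unfolding openin_subtopology by blast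
  have "z \<in> U" "z \<in> G" using N G by auto
  then obtain W \<psi> where W: "flat_box X k l A W \<psi>" "z \<in> W" "W \<subseteq> U \<inter> G"
      "\<And>z w. snd (\<psi> z) = snd (\<psi> w) \<longleftrightarrow> snd (\<phi> z) = snd (\<phi> w)"
    using flat_box_in_chart[OF fm N(3) _ G(1)] by blast
  have "W \<inter> S = {v\<in>W. snd (\<psi> v) = snd (\<psi> z)}"
  proof (intro subset_antisym subsetI)
    fix v assume v: "v \<in> W \<inter> S"
    then have "v \<in> N" using W(3) G(2) by blast
    then show "v \<in> {v\<in>W. snd (\<psi> v) = snd (\<psi> z)}" using N(5)[of v] W(4)[of v z] v by auto
  next
    fix v assume "v \<in> {v\<in>W. snd (\<psi> v) = snd (\<psi> z)}"
    then have v: "v \<in> W" "snd (\<psi> z) = snd (\<psi> v)" by auto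
    then show "v \<in> W \<inter> S"
      using saturated_plaque_relD[OF S flat_box_plaque_rel[OF W(1,2) v] N(6)] by blast
  qed
  then show thesis using that W(1,2) by blast
qed

lemma plaque_closed_leaf: "plaque_closed X k l A (leaf X A p)"
  unfolding plaque_closed_def leaf_def same_leaf_def
  by (auto intro: rtranclp.rtrancl_into_rtrancl flat_box_plaque_rel)

text \<open>Plaques are connected, so a clopen part of \<open>S\<close> contains each plaque that it
  meets; minimality leaves only the empty part and \<open>S\<close>.\<close>

lemma minimal_solenoid_connected:
  assumes "minimal_solenoid X k l A S"
  shows "connectedin X S"
proof -
  have S: "compactin X S" "saturated X A S"
    using assms by (auto simp: minimal_solenoid_def solenoid_def)
  have SX: "S \<subseteq> topspace X" using S(1) compactin_subset_topspace by blast
  have "connected_space (subtopology X S)"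
    unfolding connected_space_clopen_in
  proof (intro allI impI)
    fix Q assume Q: "openin (subtopology X S) Q \<and> closedin (subtopology X S) Q"
    have "plaque_closed X k l A Q"
      unfolding plaque_closed_def
    proof (intro allI impI)
      fix W \<psi> z w
      assume fb: "flat_box X k l A W \<psi>" and z: "z \<in> W" and w: "w \<in> W" and eq: "snd (\<psi> z) = snd (\<psi> w)"
        and zQ: "z \<in> Q"
      let ?C = "{v\<in>W. snd (\<psi> v) = snd (\<psi> z)}"
      have "z \<in> S" using zQ Q openin_subset by fastforce
      have "?C \<subseteq> S"
      proof
        fix v assume "v \<in> ?C"
        then have v: "v \<in> W" "snd (\<psi> z) = snd (\<psi> v)" by auto
        show "v \<in> S"
          by (rule saturated_plaque_relD[OF S(2) flat_box_plaque_rel[OF fb z v] \<open>z \<in> S\<close>])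
      qed
      then have "connectedin (subtopology X S) ?C"
        using flat_box_plaque_connectedin[OF fb z] by (simp add: connectedin_subtopology)
      then have "?C \<subseteq> Q \<or> disjnt ?C Q" using Q connectedin_clopen_cases by blast
      then show "w \<in> Q" using z w eq zQ by (auto simp: disjnt_def)
    qed
    then have "Q \<noteq> {} \<longrightarrow> Q = S" using minimal_solenoid_plaque_closed[OF assms] Q by blast
    then show "Q = {} \<or> Q = topspace (subtopology X S)" using SX by auto
  qed
  then show ?thesis using SX by (simp add: connectedin_def)
qed

section \<open>Flat boxes as manifold charts and as flow boxes\<close>

lemma prod_Euclidean_space_homeomorphic:
  "prod_topology (Euclidean_space k) (Euclidean_space 1) homeomorphic_space Euclidean_space (k + 1)"
proof -
  define f where "f = (\<lambda>(x::nat\<Rightarrow>real, y::nat\<Rightarrow>real) i. if i < k then x i else if i = k then y 0 else 0)"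
  define g where "g x = ((\<lambda>i. if i < k then x i else 0), (\<lambda>i::nat. if i = 0 then x k else 0))" for x :: "nat \<Rightarrow> real"
  have tE: "topspace (Euclidean_space n) = {x. \<forall>i\<ge>n. x i = 0}" for n by (rule topspace_Euclidean_space)
  have E: "Euclidean_space n = top_of_set {x. \<forall>i\<ge>n. x i = 0}" for n
    using Euclidean_space_eq_top_of_set[of n] tE by simp
  have P: "prod_topology (Euclidean_space k) (Euclidean_space 1) = top_of_set ({x. \<forall>i\<ge>k. x i = 0} \<times> {x. \<forall>i\<ge>1. x i = 0})"
    unfolding E by (simp add: prod_topology_subtopology_eu)
  have cf: "continuous_on S f" for S
    unfolding f_def case_prod_unfold
  proof (rule continuous_on_coordinatewise_then_product)
    fix i
    have "continuous_on S (\<lambda>p::(nat\<Rightarrow>real)\<times>(nat\<Rightarrow>real). fst p i)" "continuous_on S (\<lambda>p::(nat\<Rightarrow>real)\<times>(nat\<Rightarrow>real). snd p 0)"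
      by (auto intro!: continuous_on_product_then_coordinatewise continuous_on_fst continuous_on_snd continuous_on_id)
    then show "continuous_on S (\<lambda>p::(nat\<Rightarrow>real)\<times>(nat\<Rightarrow>real). if i < k then fst p i else if i = k then snd p 0 else 0)"
      by (cases "i < k"; cases "i = k") simp_all
  qed
  have cg: "continuous_on S g" for S
    unfolding g_def
  proof (intro continuous_on_Pair continuous_on_coordinatewise_then_product)
    show "continuous_on S (\<lambda>x::nat\<Rightarrow>real. if i < k then x i else 0)" for i
      using continuous_on_coordinate[of S i] by (cases "i < k") simp_all
    show "continuous_on S (\<lambda>x::nat\<Rightarrow>real. if i = 0 then x k else 0)" for i :: nat
      using continuous_on_coordinate[of S k] by (cases "i = 0") simp_all
  qed
  have "homeomorphic_maps (top_of_set ({x. \<forall>i\<ge>k. x i = 0} \<times> {x. \<forall>i\<ge>1. x i = 0})) (top_of_set {x. \<forall>i\<ge>k+1. x i = 0}) f g"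
    unfolding homeomorphic_maps_def using cf cg
    by (auto simp: f_def g_def fun_eq_iff not_less)
  then show ?thesis
    unfolding P unfolding E homeomorphic_space_def by blast
qed

lemma flat_box_homeomorphic_Euclidean_space:
  assumes fb: "flat_box X k 1 A W \<psi>"
  shows "subtopology X W homeomorphic_space Euclidean_space (k + 1)"
proof -
  have "subtopology X W homeomorphic_space
      prod_topology (subtopology (Euclidean_space k) (disc k)) (subtopology (Euclidean_space 1) (disc 1))"
    using flat_box_homeomorphic_map[OF fb] homeomorphic_map_imp_homeomorphic_space
    by (metis subtopology_model_space_Times)
  also have "prod_topology (subtopology (Euclidean_space k) (disc k)) (subtopology (Euclidean_space 1) (disc 1))
      homeomorphic_space prod_topology (Euclidean_space k) (Euclidean_space 1)"
    by (intro homeomorphic_space_prod_topology disc_homeomorphic_Euclidean_space)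
  finally show ?thesis using prod_Euclidean_space_homeomorphic homeomorphic_space_trans by blast
qed

text \<open>The box has the same plaques as a chart of \<open>A\<close>, so it inherits that chart's
  compatibility with the whole atlas and is itself a foliated chart.\<close>

lemma flat_box_flow_box:
  assumes fm: "foliated_manifold X k l A" and fb: "flat_box X k l A W \<psi>" and "W \<subseteq> S"
  shows "flow_box X k l A S W \<psi> (disc l)"
proof -
  obtain U \<phi> where U: "(U, \<phi>) \<in> A" "W \<subseteq> U"
      "\<And>z w. snd (\<psi> z) = snd (\<psi> w) \<longleftrightarrow> snd (\<phi> z) = snd (\<phi> w)"
    using fb by (auto simp: flat_box_def)
  have "openin (model_space k l) (disc k \<times> disc l)"
    unfolding model_space_def using openin_disc by (simp add: openin_prod_Times_iff)
  then have "is_chart X k l (W, \<psi>)"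
    using flat_box_openin[OF fb] flat_box_homeomorphic_map[OF fb] flat_box_image[OF fb]
    by (simp add: is_chart_def)
  moreover have "foliated_transition (W, \<psi>) d \<and> foliated_transition d (W, \<psi>)" if d: "d \<in> A" for d
  proof -
    have "foliated_transition (U, \<phi>) d" "foliated_transition d (U, \<phi>)"
      using fm U(1) d unfolding foliated_manifold_def by blast+
    then show ?thesis
      using U(2) unfolding foliated_transition_def by (cases d) (simp add: U(3), blast)
  qed
  ultimately have "foliated_chart X k l A (W, \<psi>)" unfolding foliated_chart_def by blast
  moreover have "openin (subtopology X S) W"
    using openin_subtopology_Int2[OF flat_box_openin[OF fb], of S] \<open>W \<subseteq> S\<close> by (simp add: Int_absorb1)
  ultimately show ?thesis
    unfolding flow_box_def using \<open>W \<subseteq> S\<close> disc_subset flat_box_homeomorphic_map[OF fb] by blast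
qed

section \<open>Transversals\<close>

lemma Euclidean_space_1_eqI:
  assumes "y \<in> topspace (Euclidean_space 1)" "y' \<in> topspace (Euclidean_space 1)" "y 0 = y' 0"
  shows "y = y'"
proof
  fix i show "y i = y' i"
    using assms by (cases "i = 0") (auto simp: topspace_Euclidean_space)
qed

text \<open>The one-dimensional Euclidean space consists of sequences supported at index 0; this
  reads \<open>K\<close> as a subset of the real line.\<close>

definition heights :: "(nat \<Rightarrow> real) set \<Rightarrow> real set" where
  "heights K = (\<lambda>y. y 0) ` K"

lemma flow_box_topspace:
  assumes "flow_box X k l A S U \<phi> K"
  shows "topspace (subtopology (model_space k l) (disc k \<times> K)) = disc k \<times> K"
  using assms disc_subset by (auto simp: flow_box_def topspace_model_space)

lemma flow_box_bij:
  assumes fb: "flow_box X k l A S U \<phi> K"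
  shows "U \<subseteq> topspace X" "\<phi> ` U = disc k \<times> K" "inj_on \<phi> U"
proof -
  have op: "openin (subtopology X S) U" using fb by (simp add: flow_box_def)
  then show UX: "U \<subseteq> topspace X" using openin_subset by fastforce
  have hom: "homeomorphic_map (subtopology X U) (subtopology (model_space k l) (disc k \<times> K)) \<phi>"
    using fb by (simp add: flow_box_def)
  show "\<phi> ` U = disc k \<times> K"
    using homeomorphic_imp_surjective_map[OF hom] UX flow_box_topspace[OF fb]
    by (simp add: Int_absorb1)
  show "inj_on \<phi> U"
    using homeomorphic_imp_injective_map[OF hom] UX by (simp add: Int_absorb1)
qed

lemma flow_box_snd:
  assumes "flow_box X k l A S U \<phi> K" "z \<in> U"
  shows "snd (\<phi> z) \<in> K"
proof -
  have "\<phi> z \<in> disc k \<times> K" using assms(2) flow_box_bij(2)[OF assms(1)] by blast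
  then show ?thesis by (simp add: mem_Times_iff)
qed

lemma flow_box_continuous_height:
  assumes fb: "flow_box X k l A S U \<phi> K"
  shows "continuous_map (subtopology X U) euclideanreal (\<lambda>z. snd (\<phi> z) 0)"
proof -
  have "continuous_map (subtopology X U) (subtopology (model_space k l) (disc k \<times> K)) \<phi>"
    using fb homeomorphic_imp_continuous_map by (auto simp: flow_box_def)
  then have "continuous_map (subtopology X U) (prod_topology (Euclidean_space k) (Euclidean_space l)) \<phi>"
    by (simp add: continuous_map_in_subtopology model_space_def)
  then have "continuous_map (subtopology X U) (Euclidean_space l) (snd \<circ> \<phi>)"
    using continuous_map_snd by (rule continuous_map_compose)
  moreover have "continuous_map (Euclidean_space l) euclideanreal (\<lambda>y. y 0)"
    unfolding continuous_map_Euclidean_space_iff by (rule continuous_on_coordinate)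
  ultimately have "continuous_map (subtopology X U) euclideanreal ((\<lambda>y. y 0) \<circ> (snd \<circ> \<phi>))"
    by (rule continuous_map_compose)
  then show ?thesis by (simp add: o_def)
qed

lemma zero_section_homeomorphic_heights:
  assumes K: "K \<subseteq> topspace (Euclidean_space 1)"
  shows "homeomorphic_map (subtopology (model_space k 1) ({\<lambda>i. 0} \<times> K)) (top_of_set (heights K)) (\<lambda>u. snd u 0)"
proof -
  have "(\<lambda>i. 0) \<in> topspace (Euclidean_space k)" by (simp add: topspace_Euclidean_space)
  then have eq: "subtopology (model_space k 1) ({\<lambda>i. 0} \<times> K) = top_of_set ({\<lambda>i. 0} \<times> K)"
    using K by (simp add: subtopology_model_space_Times subtopology_Euclidean_space prod_topology_subtopology_eu)
  define g :: "real \<Rightarrow> (nat \<Rightarrow> real) \<times> (nat \<Rightarrow> real)" where "g t = ((\<lambda>i. 0), (\<lambda>i. if i = 0 then t else 0))" for t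
  have g: "g (y 0) = ((\<lambda>i. 0), y)" if "y \<in> K" for y
    using K that by (auto simp: g_def topspace_Euclidean_space fun_eq_iff)
  have "continuous_on (heights K) g"
    unfolding g_def
  proof (intro continuous_on_Pair continuous_on_coordinatewise_then_product)
    show "continuous_on (heights K) (\<lambda>t::real. if i = (0::nat) then t else 0)" for i
      by (cases "i = 0") simp_all
  qed auto
  moreover have "continuous_on ({\<lambda>i. 0} \<times> K) (\<lambda>u. snd u 0)"
    by (rule continuous_on_product_then_coordinatewise[OF continuous_on_snd[OF continuous_on_id]])
  ultimately have "homeomorphic_maps (top_of_set ({\<lambda>i. 0} \<times> K)) (top_of_set (heights K)) (\<lambda>u. snd u 0) g"
    unfolding homeomorphic_maps_def using g by (auto simp: heights_def)
  then show ?thesis unfolding eq homeomorphic_map_maps by blast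
qed

text \<open>Restricting the flow box to its zero section makes \<open>T\<close> near
  \<open>p\<close> a copy of a subset of the line. The box is kept in the conclusion, because it
  carries information between \<open>T\<close> and \<open>S\<close>.\<close>

proposition transversal_chart:
  assumes T: "transversal X k 1 A S T" and p: "p \<in> T"
  obtains V U \<phi> K where "openin (subtopology X T) V" "p \<in> V" "flow_box X k 1 A S U \<phi> K" "V \<subseteq> U"
    "homeomorphic_map (subtopology X V) (top_of_set (heights K)) (\<lambda>z. snd (\<phi> z) 0)"
proof -
  obtain V0 where V0: "openin (subtopology X S) V0" "p \<in> V0" "local_transversal X k 1 A S p (V0 \<inter> T)"
    using T p unfolding transversal_def by blast
  obtain U \<phi> K where U: "flow_box X k 1 A S U \<phi> K" "V0 \<inter> T \<subseteq> U" "\<phi> ` (V0 \<inter> T) = {\<lambda>i. 0} \<times> K"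
    using V0(3) unfolding local_transversal_def by blast
  have TS: "T \<subseteq> S" using T by (simp add: transversal_def)
  obtain G where G: "openin X G" "V0 = G \<inter> S" using V0(1) unfolding openin_subtopology by blast
  have "V0 \<inter> T = T \<inter> G" using G(2) TS by blast
  then have op: "openin (subtopology X T) (V0 \<inter> T)" using openin_subtopology_Int2[OF G(1), of T] by simp
  have K: "K \<subseteq> topspace (Euclidean_space 1)"
    and hom: "homeomorphic_map (subtopology X U) (subtopology (model_space k 1) (disc k \<times> K)) \<phi>"
    using U(1) by (auto simp: flow_box_def)
  have "homeomorphic_map (subtopology (subtopology X U) (V0 \<inter> T))
      (subtopology (subtopology (model_space k 1) (disc k \<times> K)) ({\<lambda>i. 0} \<times> K)) \<phi>"
  proof (rule homeomorphic_map_subtopologies[OF hom])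
    have "topspace (subtopology X U) \<inter> (V0 \<inter> T) = V0 \<inter> T" using flow_box_bij(1)[OF U(1)] U(2) by auto
    moreover have "(disc k \<times> K) \<inter> ({\<lambda>i. 0} \<times> K) = {\<lambda>i. 0} \<times> K" using zero_in_disc by auto
    ultimately show "\<phi> ` (topspace (subtopology X U) \<inter> (V0 \<inter> T))
      = topspace (subtopology (model_space k 1) (disc k \<times> K)) \<inter> ({\<lambda>i. 0} \<times> K)"
      using U(3) flow_box_topspace[OF U(1)] by simp
  qed
  moreover have "U \<inter> (V0 \<inter> T) = V0 \<inter> T" "(disc k \<times> K) \<inter> ({\<lambda>i. 0} \<times> K) = {\<lambda>i. 0} \<times> K"
    using U(2) zero_in_disc by auto
  ultimately have "homeomorphic_map (subtopology X (V0 \<inter> T)) (subtopology (model_space k 1) ({\<lambda>i. 0} \<times> K)) \<phi>"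
    by (simp add: subtopology_subtopology)
  then have "homeomorphic_map (subtopology X (V0 \<inter> T)) (top_of_set (heights K)) ((\<lambda>u. snd u 0) \<circ> \<phi>)"
    using zero_section_homeomorphic_heights[OF K] by (rule homeomorphic_map_compose)
  then have "homeomorphic_map (subtopology X (V0 \<inter> T)) (top_of_set (heights K)) (\<lambda>z. snd (\<phi> z) 0)"
    by (simp add: o_def)
  then show thesis
    using that[OF op _ U(1,2)] V0(2) p by blast
qed

text \<open>Over an interval of heights the box contains a disc times an open interval. The ambient
  chart pulls this product back to an open subset of \<open>X\<close>, and by injectivity of that
  chart each of its points already lies in \<open>U\<close>, hence in \<open>S\<close>.\<close>

lemma flow_box_interval_interior:
  assumes fb: "flow_box X k 1 A S U \<phi> K" and ab: "{a<..<b} \<subseteq> heights K"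
    and z: "z \<in> U" "a < snd (\<phi> z) 0" "snd (\<phi> z) 0 < b"
  shows "z \<in> X interior_of S"
proof -
  obtain V \<psi> where V: "foliated_chart X k 1 A (V, \<psi>)" "U = V \<inter> S" "\<And>z. z \<in> U \<Longrightarrow> \<phi> z = \<psi> z"
    using fb unfolding flow_box_def by blast
  have K: "K \<subseteq> topspace (Euclidean_space 1)" using fb by (simp add: flow_box_def)
  have ch: "openin X V" "homeomorphic_map (subtopology X V) (subtopology (model_space k 1) (\<psi> ` V)) \<psi>"
    "\<psi> ` V \<subseteq> topspace (model_space k 1)"
    using V(1) openin_subset by (auto simp: foliated_chart_def is_chart_def)
  have VX: "V \<subseteq> topspace X" using ch(1) openin_subset by blast
  have inj: "inj_on \<psi> V"
    using homeomorphic_imp_injective_map[OF ch(2)] VX by (simp add: Int_absorb1)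
  define J where "J = {y \<in> topspace (Euclidean_space 1). y 0 \<in> {a<..<b}}"
  have "openin (Euclidean_space 1) J"
    unfolding J_def
    by (rule openin_continuous_map_preimage[of _ euclideanreal])
       (auto simp: continuous_map_Euclidean_space_iff continuous_on_coordinate)
  then have G: "openin (model_space k 1) (disc k \<times> J)"
    unfolding model_space_def using openin_disc by (simp add: openin_prod_Times_iff)
  have "continuous_map (subtopology X V) (model_space k 1) \<psi>"
    using homeomorphic_imp_continuous_map[OF ch(2)] by (simp add: continuous_map_in_subtopology)
  from openin_continuous_map_preimage[OF this G]
  have "openin (subtopology X V) {v \<in> V. \<psi> v \<in> disc k \<times> J}"
    using VX by (simp add: Int_absorb1)
  then have op: "openin X {v \<in> V. \<psi> v \<in> disc k \<times> J}" using ch(1) openin_trans_full by blast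
  have "{v \<in> V. \<psi> v \<in> disc k \<times> J} \<subseteq> S"
  proof
    fix v assume v: "v \<in> {v \<in> V. \<psi> v \<in> disc k \<times> J}"
    then obtain x y where xy: "\<psi> v = (x, y)" "x \<in> disc k" "y \<in> J" by auto
    then have "y 0 \<in> heights K" "y \<in> topspace (Euclidean_space 1)" using ab by (auto simp: J_def)
    then obtain y' where "y' \<in> K" "y 0 = y' 0" by (auto simp: heights_def)
    then have "y = y'"
      using Euclidean_space_1_eqI[of y y'] K \<open>y \<in> topspace _\<close> by blast
    then have "(x, y) \<in> \<phi> ` U" using \<open>y' \<in> K\<close> xy(2) flow_box_bij(2)[OF fb] by simp
    then obtain u where u: "u \<in> U" "(x, y) = \<phi> u" by blast
    then have "\<psi> u = \<psi> v" using V(3)[OF u(1)] xy(1) by simp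
    then have "u = v" using inj_onD[OF inj] u(1) V(2) v by auto
    then show "v \<in> S" using u(1) V(2) by blast
  qed
  then have "{v \<in> V. \<psi> v \<in> disc k \<times> J} \<subseteq> X interior_of S" using op by (simp add: interior_of_maximal)
  moreover have "z \<in> {v \<in> V. \<psi> v \<in> disc k \<times> J}"
  proof -
    have "\<phi> z \<in> disc k \<times> K" using z(1) flow_box_bij(2)[OF fb] by blast
    then have "fst (\<phi> z) \<in> disc k" "snd (\<phi> z) \<in> topspace (Euclidean_space 1)" using K by (auto simp: mem_Times_iff)
    then show ?thesis using z V(2) V(3)[OF z(1)] by (auto simp: J_def mem_Times_iff)
  qed
  ultimately show ?thesis by (rule subsetD)
qed

text \<open>If \<open>S\<close> is open, so is the box in \<open>X\<close>, and then its image
  \<open>disc k \<times> K\<close> is open; as the disc is nonempty, the second factor is open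
  too.\<close>

lemma flow_box_open_heights:
  assumes fb: "flow_box X k 1 A S U \<phi> K" and S: "openin X S"
  shows "open (heights K)"
proof (cases "K = {}")
  case False
  obtain V \<psi> where V: "foliated_chart X k 1 A (V, \<psi>)" "U = V \<inter> S" "\<And>z. z \<in> U \<Longrightarrow> \<phi> z = \<psi> z"
    using fb unfolding flow_box_def by blast
  have K: "K \<subseteq> topspace (Euclidean_space 1)" using fb by (simp add: flow_box_def)
  have ch: "openin X V" "homeomorphic_map (subtopology X V) (subtopology (model_space k 1) (\<psi> ` V)) \<psi>"
    "openin (model_space k 1) (\<psi> ` V)"
    using V(1) by (auto simp: foliated_chart_def is_chart_def)
  have "openin (subtopology X V) U" using openin_subtopology_Int2[OF S] V(2) by simp
  then have "openin (subtopology (model_space k 1) (\<psi> ` V)) (\<psi> ` U)"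
    using homeomorphic_imp_open_map[OF ch(2)] by (simp add: open_map_def)
  then have "openin (model_space k 1) (\<psi> ` U)" using ch(3) openin_trans_full by blast
  moreover have "\<psi> ` U = disc k \<times> K" using V(3) flow_box_bij(2)[OF fb] by (metis image_cong)
  ultimately have "openin (Euclidean_space 1) K"
    using zero_in_disc[of k] by (auto simp: model_space_def openin_prod_Times_iff)
  moreover have "continuous_map euclideanreal (Euclidean_space 1) (\<lambda>t i. if i < 1 then t else 0)"
    unfolding continuous_map_componentwise_Euclidean_space by simp
  ultimately have "openin euclideanreal {t \<in> topspace euclideanreal. (\<lambda>i. if i < 1 then t else 0) \<in> K}"
    by (intro openin_continuous_map_preimage)
  moreover have "heights K = {t. (\<lambda>i::nat. if i < 1 then t else 0) \<in> K}"
  proof (intro subset_antisym subsetI)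
    fix t assume "t \<in> heights K"
    then obtain y where y: "y \<in> K" "t = y 0" by (auto simp: heights_def)
    have eq: "(\<lambda>i::nat. if i < 1 then t else 0) = y"
      by (rule Euclidean_space_1_eqI) (use y K in \<open>auto simp: topspace_Euclidean_space\<close>)
    show "t \<in> {t. (\<lambda>i::nat. if i < 1 then t else 0) \<in> K}"
      unfolding mem_Collect_eq eq by (rule y(1))
  next
    fix t assume "t \<in> {t. (\<lambda>i::nat. if i < 1 then t else 0) \<in> K}"
    then show "t \<in> heights K"
      unfolding heights_def by (intro image_eqI[of _ _ "\<lambda>i::nat. if i < 1 then t else 0"]) auto
  qed
  ultimately show ?thesis by simp
qed (simp add: heights_def)

text \<open>An arc is connected, so it stays in the component that it meets. Components are
  therefore open, by compactness finite in number, and each is again covered by arcs.\<close>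

lemma compact_1_manifold_components_are_circles:
  assumes Haus: "Hausdorff_space Y" and cpt: "compact_space Y"
    and arcs: "\<And>p. p \<in> topspace Y \<Longrightarrow> \<exists>g. open_arc Y g \<and> p \<in> range g"
  shows "finite (connected_components_of Y)"
    and "\<And>C. C \<in> connected_components_of Y \<Longrightarrow> subtopology Y C homeomorphic_space nsphere 1"
proof -
  have arc_in: "range g \<subseteq> C" if C: "C \<in> connected_components_of Y" and g: "open_arc Y g" "range g \<inter> C \<noteq> {}" for C g
  proof (rule connected_components_of_maximal[OF C])
    have "connectedin Y (g ` UNIV)"
      using g(1) by (intro connectedin_continuous_map_image[of euclideanreal]) (auto simp: open_arc_def)
    then show "connectedin Y (range g)" .
    show "\<not> disjnt C (range g)" using g(2) by (auto simp: disjnt_def)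
  qed
  have sub: "C \<subseteq> topspace Y" if "C \<in> connected_components_of Y" for C
    using that connected_components_of_subset by blast
  have op: "openin Y C" if C: "C \<in> connected_components_of Y" for C
  proof (subst openin_subopen, intro ballI)
    fix p assume p: "p \<in> C"
    then obtain g where g: "open_arc Y g" "p \<in> range g" using arcs sub[OF C] by blast
    then show "\<exists>T. openin Y T \<and> p \<in> T \<and> T \<subseteq> C"
      using open_arc_openin_range[OF g(1)] arc_in[OF C g(1)] p by blast
  qed
  show "finite (connected_components_of Y)"
  proof -
    have "\<exists>F. finite F \<and> F \<subseteq> connected_components_of Y \<and> topspace Y \<subseteq> \<Union>F"
      using cpt unfolding compact_space_def
      by (rule compactinD) (use op Union_connected_components_of[of Y] in auto)
    then obtain F where F: "finite F" "F \<subseteq> connected_components_of Y" "topspace Y \<subseteq> \<Union>F" by blast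
    have "connected_components_of Y \<subseteq> F"
    proof
      fix C assume C: "C \<in> connected_components_of Y"
      then obtain p where p: "p \<in> C" using nonempty_connected_components_of by fastforce
      then obtain D where D: "D \<in> F" "p \<in> D" using F(3) sub[OF C] by blast
      then have "C = D"
        using pairwiseD[OF pairwise_disjoint_connected_components_of C, of D] F(2) p by (auto simp: disjnt_iff)
      then show "C \<in> F" using D by simp
    qed
    then show ?thesis using F(1) finite_subset by blast
  qed
  show "subtopology Y C homeomorphic_space nsphere 1" if C: "C \<in> connected_components_of Y" for C
  proof (rule compact_connected_1_manifold_is_circle)
    show "Hausdorff_space (subtopology Y C)" using Haus by (rule Hausdorff_space_subtopology)
    have "closedin Y C" using C closedin_connected_components_of by blast
    then have "compactin Y C" using cpt closedin_compact_space by blast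
    then show "compact_space (subtopology Y C)" by (simp add: compactin_subspace)
    show "connected_space (subtopology Y C)"
      using connectedin_connected_components_of[OF C] by (simp add: connectedin_def)
    show "topspace (subtopology Y C) \<noteq> {}"
      using nonempty_connected_components_of[OF C] sub[OF C] by (simp add: Int_absorb1)
    fix p assume "p \<in> topspace (subtopology Y C)"
    then have p: "p \<in> C" "p \<in> topspace Y" by auto
    then obtain g where g: "open_arc Y g" "p \<in> range g" using arcs by blast
    then have gC: "range g \<subseteq> C" using arc_in[OF C g(1)] p by blast
    have "continuous_map euclideanreal (subtopology Y C) g"
      using g(1) gC by (auto simp: open_arc_def continuous_map_in_subtopology)
    moreover have "open_map euclideanreal (subtopology Y C) g"
      unfolding open_map_def
    proof (intro allI impI)
      fix U :: "real set" assume "openin euclideanreal U"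
      then have "openin Y (g ` U)" using g(1) by (auto simp: open_arc_def open_map_def)
      from openin_subtopology_Int2[OF this, of C] show "openin (subtopology Y C) (g ` U)"
        using gC by (metis image_mono inf.absorb2 order_trans subset_UNIV)
    qed
    ultimately have "open_arc (subtopology Y C) g" using g(1) by (simp add: open_arc_def)
    then show "\<exists>g. open_arc (subtopology Y C) g \<and> p \<in> range g" using g(2) by blast
  qed
qed

lemma transversal_open_arc:
  assumes T: "transversal X k 1 A S T" and S: "openin X S" and p: "p \<in> T"
  shows "\<exists>g. open_arc (subtopology X T) g \<and> p \<in> range g"
proof -
  obtain V U \<phi> K where V: "openin (subtopology X T) V" "p \<in> V" "flow_box X k 1 A S U \<phi> K"
    "homeomorphic_map (subtopology X V) (top_of_set (heights K)) (\<lambda>z. snd (\<phi> z) 0)" "V \<subseteq> U"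
    by (rule transversal_chart[OF T p]) (rule that; assumption)
  define h where "h z = snd (\<phi> z) 0" for z
  have VT: "V \<subseteq> T" "V \<subseteq> topspace X" using openin_subset[OF V(1)] by auto
  have h: "homeomorphic_map (subtopology X V) (top_of_set (heights K)) h"
    using V(4) unfolding h_def .
  then obtain h' where h': "homeomorphic_maps (subtopology X V) (top_of_set (heights K)) h h'"
    using homeomorphic_map_maps by blast
  have hp: "h p \<in> heights K"
    using homeomorphic_imp_surjective_map[OF h] V(2) VT by auto
  have "open (heights K)" by (rule flow_box_open_heights[OF V(3) S])
  then obtain e where e: "e > 0" "ball (h p) e \<subseteq> heights K" using hp open_contains_ball by blast
  \<comment> \<open>The arctangent squeezes the whole line into the interval of radius
    \<open>e\<close> around \<open>h p\<close>, with 0 going to the centre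
    \<open>h p\<close>.\<close>
  define b where "b s = h p + (2 * e / pi) * arctan s" for s
  have bK: "b s \<in> heights K" for s
  proof -
    have "\<bar>arctan s\<bar> < pi / 2" using arctan_bounded[of s] by (simp add: abs_less_iff) linarith
    then have "(2 * e / pi) * \<bar>arctan s\<bar> < (2 * e / pi) * (pi / 2)"
      using e(1) by (intro mult_strict_left_mono) auto
    then have "\<bar>b s - h p\<bar> < e" using e(1) by (simp add: b_def abs_mult)
    then show ?thesis using e(2) by (auto simp: dist_real_def abs_minus_commute subset_iff)
  qed
  have contb: "continuous_on UNIV b" unfolding b_def by (intro continuous_intros)
  have injb: "inj b" using e(1) by (auto simp: b_def inj_def arctan_eq_iff)
  have homh': "homeomorphic_map (top_of_set (heights K)) (subtopology X V) h'"
    using h' homeomorphic_maps_map by blast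
  have TV: "subtopology (subtopology X T) V = subtopology X V"
    using VT(1) by (simp add: subtopology_subtopology Int_absorb1)
  have "continuous_map euclideanreal (top_of_set (heights K)) b"
    using contb bK by (auto simp: continuous_map_in_subtopology)
  then have c1: "continuous_map euclideanreal (subtopology X V) (h' \<circ> b)"
    using homeomorphic_imp_continuous_map[OF homh'] by (rule continuous_map_compose)
  then have "continuous_map euclideanreal (subtopology X T) (h' \<circ> b)"
    using TV by (metis continuous_map_in_subtopology)
  moreover have "open_map euclideanreal (subtopology X T) (h' \<circ> b)"
    unfolding open_map_def
  proof (intro allI impI)
    fix G :: "real set" assume "openin euclideanreal G"
    then have "open (b ` G)"
      using injective_into_1d_imp_open_map_UNIV[of G UNIV b] contb injb by auto
    moreover have "b ` G \<subseteq> heights K" using bK by blast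
    ultimately have "openin (top_of_set (heights K)) (b ` G)" by (simp add: open_openin_trans open_subset)
    then have "openin (subtopology X V) (h' ` b ` G)"
      using homeomorphic_imp_open_map[OF homh'] by (simp add: open_map_def)
    then have "openin (subtopology X T) (h' ` b ` G)"
      using V(1) TV openin_trans_full by metis
    then show "openin (subtopology X T) ((h' \<circ> b) ` G)" by (simp add: image_comp)
  qed
  moreover have "inj (h' \<circ> b)"
  proof (rule injI)
    fix x y assume "(h' \<circ> b) x = (h' \<circ> b) y"
    then have "b x = b y"
      using inj_onD[OF homeomorphic_imp_injective_map[OF homh'], of "b x" "b y"] bK by simp
    then show "x = y" using injb by (simp add: inj_eq)
  qed
  moreover have "(h' \<circ> b) 0 = p"
    using h' V(2) VT by (simp add: b_def homeomorphic_maps_def subset_iff)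
  ultimately show ?thesis unfolding open_arc_def by (metis rangeI)
qed

text \<open>Cutting at two missing heights around \<open>h p\<close> gives a piece that is both open
  and closed in \<open>V\<close>. But \<open>V\<close> is only open in \<open>T\<close>, so the
  piece is first confined to a closed neighbourhood \<open>D\<close> of \<open>p\<close> that avoids
  \<open>q\<close>; there closedness carries over to \<open>T\<close>.\<close>

lemma transversal_clopen_separation:
  assumes T: "transversal X k 1 A S T" and Haus: "Hausdorff_space X" and int: "X interior_of S = {}"
    and p: "p \<in> T" and q: "q \<in> T" "p \<noteq> q"
  shows "\<exists>C. openin (subtopology X T) C \<and> closedin (subtopology X T) C \<and> p \<in> C \<and> q \<notin> C"
proof -
  let ?Y = "subtopology X T"
  have TX: "compactin X T" "T \<subseteq> topspace X"
    using T compactin_subset_topspace by (auto simp: transversal_def)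
  have cptY: "compact_space ?Y" using TX(1) by (simp add: compactin_subspace)
  have HausY: "Hausdorff_space ?Y" using Haus by (rule Hausdorff_space_subtopology)
  obtain V U \<phi> K where V: "openin ?Y V" "p \<in> V" "flow_box X k 1 A S U \<phi> K"
    "homeomorphic_map (subtopology X V) (top_of_set (heights K)) (\<lambda>z. snd (\<phi> z) 0)" "V \<subseteq> U"
    by (rule transversal_chart[OF T p]) (rule that; assumption)
  define h where "h z = snd (\<phi> z) 0" for z
  have h: "homeomorphic_map (subtopology X V) (top_of_set (heights K)) h"
    using V(4) unfolding h_def .
  have VT: "V \<subseteq> T" using openin_subset[OF V(1)] by auto
  have TV: "subtopology ?Y V = subtopology X V"
    using VT by (simp add: subtopology_subtopology Int_absorb1)
  have topV: "topspace (subtopology X V) = V" using VT TX(2) by auto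
  have hV: "h ` V = heights K" using homeomorphic_imp_surjective_map[OF h] topV by simp
  have injh: "inj_on h V" using homeomorphic_imp_injective_map[OF h] topV by simp
  have "closedin ?Y {q}" using HausY q TX(2) closedin_Hausdorff_sing_eq[of ?Y q] by auto
  then have "openin ?Y (V - {q})" using V(1) by (rule openin_diff[rotated])
  then have Vq: "openin ?Y (V - {q}) \<and> p \<in> V - {q}" using V(2) q by blast
  \<comment> \<open>Regularity of the compact Hausdorff space \<open>T\<close> provides the closed
    neighbourhood \<open>D\<close>.\<close>
  have "neighbourhood_base_of (closedin ?Y) ?Y"
    using compact_Hausdorff_imp_regular_space[OF cptY HausY] neighbourhood_base_of_closedin by blast
  from this[unfolded neighbourhood_base_of, rule_format, OF Vq]
  obtain G D where G: "openin ?Y G" "closedin ?Y D" "p \<in> G" "G \<subseteq> D" "D \<subseteq> V - {q}" by blast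
  have "openin (subtopology X V) G"
    using openin_subtopology_Int2[OF G(1), of V] G(4,5) TV by (metis Diff_subset inf.absorb2 order_trans)
  then have "openin (top_of_set (heights K)) (h ` G)"
    using homeomorphic_imp_open_map[OF h] by (simp add: open_map_def)
  then obtain H where H: "open H" "h ` G = heights K \<inter> H" using openin_open by blast
  have "h p \<in> H" using H(2) G(3) by blast
  then obtain e where e: "e > 0" "ball (h p) e \<subseteq> H" using H(1) open_contains_ball by blast
  \<comment> \<open>An interval consisting of heights would give \<open>S\<close> an interior
    point.\<close>
  have gap: "\<exists>t. c < t \<and> t < d \<and> t \<notin> heights K" if cd: "c < d" for c d
  proof (rule ccontr)
    assume "\<not> ?thesis"
    then have sub: "{c<..<d} \<subseteq> heights K" by auto
    obtain t where t: "c < t" "t < d" using dense[OF cd] by blast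
    then have "t \<in> h ` V" using sub hV by auto
    then obtain v where v: "v \<in> V" "h v = t" by blast
    have "v \<in> U" "c < snd (\<phi> v) 0" "snd (\<phi> v) 0 < d"
      using v t V(5) by (auto simp: h_def)
    then show False using flow_box_interval_interior[OF V(3) sub] int by blast
  qed
  obtain a where a: "h p - e < a" "a < h p" "a \<notin> heights K" using gap[of "h p - e" "h p"] e(1) by auto
  obtain b where b: "h p < b" "b < h p + e" "b \<notin> heights K" using gap[of "h p" "h p + e"] e(1) by auto
  define C where "C = {z \<in> V. h z \<in> {a<..<b}}"
  have conth: "continuous_map (subtopology X V) euclideanreal h"
    using homeomorphic_imp_continuous_map[OF h] by (simp add: continuous_map_in_subtopology)
  have "openin (subtopology ?Y V) C"
    using openin_continuous_map_preimage[OF conth, of "{a<..<b}"] unfolding TV C_def topV by simp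
  then have opC: "openin ?Y C" using V(1) openin_trans_full by blast
  have CG: "C \<subseteq> G"
  proof
    fix z assume z: "z \<in> C"
    then have "h z \<in> heights K \<inter> H" using a b e(2) hV by (auto simp: C_def dist_real_def subset_iff)
    then obtain z' where "z' \<in> G" "h z = h z'" using H(2) by auto
    then show "z \<in> G" using inj_onD[OF injh, of z z'] z G(4,5) by (auto simp: C_def)
  qed
  \<comment> \<open>No point has height \<open>a\<close> or \<open>b\<close>, so the open and the
    closed interval cut out the same set: the former shows that it is open, the latter that it is
    closed.\<close>
  have CD: "C = {z \<in> D. h z \<in> {a..b}}"
  proof (intro subset_antisym subsetI)
    fix z assume z: "z \<in> {z \<in> D. h z \<in> {a..b}}"
    then have "z \<in> V" using G(5) by blast
    then have "h z \<noteq> a" "h z \<noteq> b" using hV a(3) b(3) by auto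
    then show "z \<in> C" using z \<open>z \<in> V\<close> by (auto simp: C_def)
  next
    fix z assume "z \<in> C"
    then show "z \<in> {z \<in> D. h z \<in> {a..b}}" using CG G(4) by (auto simp: C_def)
  qed
  have "continuous_map (subtopology X D) euclideanreal h"
    using continuous_map_from_subtopology_mono[OF conth] G(5) by blast
  then have clos: "closedin (subtopology X D) {z \<in> topspace (subtopology X D). h z \<in> {a..b}}"
    by (rule closedin_continuous_map_preimage) simp
  have "D \<subseteq> T" using G(5) VT by blast
  then have topD: "topspace (subtopology X D) = D" and eqD: "subtopology X D = subtopology ?Y D"
    using TX(2) by (auto simp: subtopology_subtopology Int_absorb1)
  have "closedin (subtopology ?Y D) C" using clos unfolding topD eqD[symmetric] CD .
  then have "closedin ?Y C" using G(2) closedin_trans_full by blast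
  moreover have "p \<in> C" using a b V(2) by (simp add: C_def)
  moreover have "q \<notin> C" using CG G(4,5) by blast
  ultimately show ?thesis using opC by blast
qed

lemma totally_disconnected_if_clopen_separated:
  assumes "\<And>x y. \<lbrakk>x \<in> topspace Y; y \<in> topspace Y; x \<noteq> y\<rbrakk>
             \<Longrightarrow> \<exists>C. openin Y C \<and> closedin Y C \<and> x \<in> C \<and> y \<notin> C"
  shows "totally_disconnected_space Y"
  unfolding totally_disconnected_space_def
proof
  fix C assume C: "C \<in> connected_components_of Y"
  then obtain p where p: "p \<in> C" using nonempty_connected_components_of by fastforce
  have CY: "C \<subseteq> topspace Y" using C connected_components_of_subset by blast
  have "C = {p}"
  proof (rule ccontr)
    assume "C \<noteq> {p}"
    then obtain q where q: "q \<in> C" "p \<noteq> q" using p by blast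
    then obtain D where D: "openin Y D" "closedin Y D" "p \<in> D" "q \<notin> D" using assms[of p q] p CY by blast
    then have "C \<subseteq> D \<or> disjnt C D"
      using connectedin_clopen_cases[OF connectedin_connected_components_of[OF C]] by blast
    then show False using p q D by (auto simp: disjnt_iff)
  qed
  then show "\<exists>p. C = {p}" by blast
qed

lemma flow_box_chart:
  assumes "flow_box X k l A S U \<phi> K"
  obtains V \<psi> where "foliated_chart X k l A (V, \<psi>)" "U = V \<inter> S" "\<And>z. z \<in> U \<Longrightarrow> \<phi> z = \<psi> z"
  using assms unfolding flow_box_def by blast

text \<open>If \<open>h p\<close> is isolated among the heights, every point of the flow box with
  height near \<open>h p\<close> has exactly that height, so near \<open>p\<close> the set
  \<open>S\<close> is one plaque of the box.\<close>

lemma isolated_in_transversal_imp_plaque_interior: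
  assumes fm: "foliated_manifold X k 1 A" and T: "transversal X k 1 A S T"
    and p: "p \<in> T" and iso: "openin (subtopology X T) {p}"
  shows "p \<in> plaque_interior X A S"
proof -
  have TS: "T \<subseteq> S" "T \<subseteq> topspace X"
    using T compactin_subset_topspace by (auto simp: transversal_def)
  obtain V U \<phi> K where V: "openin (subtopology X T) V" "p \<in> V" "flow_box X k 1 A S U \<phi> K"
    "homeomorphic_map (subtopology X V) (top_of_set (heights K)) (\<lambda>z. snd (\<phi> z) 0)" "V \<subseteq> U"
    by (rule transversal_chart[OF T p]) (rule that; assumption)
  define h where "h z = snd (\<phi> z) 0" for z
  have h: "homeomorphic_map (subtopology X V) (top_of_set (heights K)) h"
    using V(4) unfolding h_def .
  have VT: "V \<subseteq> T" using openin_subset[OF V(1)] by auto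
  have "openin (subtopology X V) {p}"
    using openin_subtopology_Int2[OF iso, of V] V(2) VT by (simp add: subtopology_subtopology Int_absorb1)
  then have "openin (top_of_set (heights K)) (h ` {p})"
    using homeomorphic_imp_open_map[OF h] unfolding open_map_def by blast
  then obtain H where H: "open H" "{h p} = heights K \<inter> H" unfolding openin_open by auto
  have K: "K \<subseteq> topspace (Euclidean_space 1)" and opU: "openin (subtopology X S) U"
    using V(3) by (auto simp: flow_box_def)
  obtain V' \<psi> where V': "foliated_chart X k 1 A (V', \<psi>)" "U = V' \<inter> S" "\<And>z. z \<in> U \<Longrightarrow> \<phi> z = \<psi> z"
    using flow_box_chart[OF V(3)] by blast
  have US: "U \<subseteq> S" using V'(2) by blast
  obtain c where "c \<in> A" "p \<in> fst c"
    using fm p TS(2) unfolding foliated_manifold_def by blast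
  then obtain U0 \<phi>0 where U0: "(U0, \<phi>0) \<in> A" "p \<in> U0" by (cases c) auto
  have opU0: "openin X U0" using fm U0(1) by (auto simp: foliated_manifold_def is_chart_def)
  \<comment> \<open>The flow box need not come from a chart of \<open>A\<close>, as
    \<open>plaque_interior\<close> demands; the transition map transfers constancy of the
    height.\<close>
  have trans: "foliated_transition (V', \<psi>) (U0, \<phi>0)" using V'(1) U0(1) by (auto simp: foliated_chart_def)
  define N where "N = {z \<in> U. h z \<in> H} \<inter> U0"
  have "openin (subtopology X U) {z \<in> topspace (subtopology X U). h z \<in> H}"
    using flow_box_continuous_height[OF V(3)] H(1) unfolding h_def
    by (intro openin_continuous_map_preimage) auto
  then have "openin (subtopology (subtopology X S) U) {z \<in> U. h z \<in> H}"
    using flow_box_bij(1)[OF V(3)] US by (simp add: Int_absorb1 subtopology_subtopology)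
  then have "openin (subtopology X S) {z \<in> U. h z \<in> H}" using opU openin_trans_full by blast
  moreover have "openin (subtopology X S) (S \<inter> U0)" by (rule openin_subtopology_Int2[OF opU0])
  ultimately have "openin (subtopology X S) ({z \<in> U. h z \<in> H} \<inter> (S \<inter> U0))" by (rule openin_Int)
  moreover have "{z \<in> U. h z \<in> H} \<inter> (S \<inter> U0) = N" using US by (auto simp: N_def)
  ultimately have opN: "openin (subtopology X S) N" by simp
  have pU: "p \<in> U" using V(2,5) by blast
  have pN: "p \<in> N" using pU U0(2) H(2) by (auto simp: N_def)
  have "snd (\<phi>0 v) = snd (\<phi>0 p)" if v: "v \<in> N" for v
  proof -
    have vU: "v \<in> U" "h v \<in> H" "v \<in> U0" using v by (auto simp: N_def)
    have "snd (\<phi> v) \<in> K" "snd (\<phi> p) \<in> K" using flow_box_snd[OF V(3)] vU(1) pU by auto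
    moreover from this have "h v \<in> heights K" by (auto simp: h_def heights_def)
    then have "h v = h p" using H(2) vU(2) by blast
    ultimately have "snd (\<phi> v) = snd (\<phi> p)"
      using Euclidean_space_1_eqI K unfolding h_def by blast
    then have "snd (\<psi> v) = snd (\<psi> p)" using V'(3) vU(1) pU by simp
    moreover have "v \<in> V' \<inter> U0" "p \<in> V' \<inter> U0" using vU pU V'(2) U0(2) by auto
    ultimately show ?thesis using trans unfolding foliated_transition_def by blast
  qed
  moreover have "N \<subseteq> U0" by (auto simp: N_def)
  ultimately show ?thesis
    unfolding plaque_interior_def using opN pN U0(1) p TS(1) by blast
qed

text \<open>A single plaque meets the local transversal at most once, because height is injective on
  the latter.\<close>

lemma plaque_interior_imp_isolated_in_transversal:
  assumes fm: "foliated_manifold X k 1 A" and T: "transversal X k 1 A S T"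
    and p: "p \<in> T" "p \<in> plaque_interior X A S"
  shows "openin (subtopology X T) {p}"
proof -
  have TS: "T \<subseteq> S" "T \<subseteq> topspace X"
    using T compactin_subset_topspace by (auto simp: transversal_def)
  obtain V U \<phi> K where V: "openin (subtopology X T) V" "p \<in> V" "flow_box X k 1 A S U \<phi> K"
    "homeomorphic_map (subtopology X V) (top_of_set (heights K)) (\<lambda>z. snd (\<phi> z) 0)" "V \<subseteq> U"
    by (rule transversal_chart[OF T p(1)]) (rule that; assumption)
  have VT: "V \<subseteq> T" using openin_subset[OF V(1)] by auto
  have inj: "inj_on (\<lambda>z. snd (\<phi> z) 0) V"
    using homeomorphic_imp_injective_map[OF V(4)] VT TS(2) by (simp add: Int_absorb1)
  obtain V' \<psi> where V': "foliated_chart X k 1 A (V', \<psi>)" "U = V' \<inter> S" "\<And>z. z \<in> U \<Longrightarrow> \<phi> z = \<psi> z"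
    using flow_box_chart[OF V(3)] by blast
  obtain N U1 \<phi>1 where N: "openin (subtopology X S) N" "p \<in> N" "(U1, \<phi>1) \<in> A" "N \<subseteq> U1"
      "\<And>v. v \<in> N \<Longrightarrow> snd (\<phi>1 v) = snd (\<phi>1 p)"
    using p(2) unfolding plaque_interior_def by blast
  have trans: "foliated_transition (U1, \<phi>1) (V', \<psi>)" using V'(1) N(3) by (auto simp: foliated_chart_def)
  have "openin (subtopology (subtopology X S) T) (T \<inter> N)" using N(1) by (rule openin_subtopology_Int2)
  then have "openin (subtopology X T) (T \<inter> N)"
    using TS(1) by (simp add: subtopology_subtopology Int_absorb1)
  then have "openin (subtopology X T) (V \<inter> (T \<inter> N))" using V(1) by (rule openin_Int[rotated])
  moreover have "V \<inter> (T \<inter> N) = {p}"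
  proof (intro subset_antisym subsetI)
    fix v assume "v \<in> V \<inter> (T \<inter> N)"
    then have v: "v \<in> V" "v \<in> N" by auto
    have "v \<in> U1 \<inter> V'" "p \<in> U1 \<inter> V'" using v V(2,5) V'(2) N(2,4) by auto
    then have "snd (\<psi> v) = snd (\<psi> p)"
      using trans N(5)[OF v(2)] unfolding foliated_transition_def by blast
    then have "snd (\<phi> v) = snd (\<phi> p)" using V'(3)[of v] V'(3)[of p] v(1) V(2,5) by (simp add: subset_iff)
    then show "v \<in> {p}" using inj_onD[OF inj _ v(1) V(2)] by simp
  qed (use V(2) p(1) N(2) in auto)
  ultimately show ?thesis by simp
qed

lemma finite_if_compact_all_isolated:
  assumes "compact_space Y" "\<And>p. p \<in> topspace Y \<Longrightarrow> openin Y {p}"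
  shows "finite (topspace Y)"
proof -
  have "\<exists>F. finite F \<and> F \<subseteq> (\<lambda>p. {p}) ` topspace Y \<and> topspace Y \<subseteq> \<Union>F"
    using assms(1) unfolding compact_space_def by (rule compactinD) (use assms(2) in auto)
  then obtain F where F: "finite F" "F \<subseteq> (\<lambda>p. {p}) ` topspace Y" "topspace Y \<subseteq> \<Union>F" by blast
  have "finite D" if "D \<in> F" for D using subsetD[OF F(2) that] by auto
  then have "finite (\<Union>F)" using F(1) by (rule finite_Union[rotated])
  then show ?thesis using F(3) finite_subset by blast
qed

section \<open>Mutual exclusion of the alternatives\<close>

lemma infinite_cantor_set: "infinite cantor_set"
proof -
  have "inj (\<lambda>n::nat. ternary (\<lambda>i. i = n))"
  proof (rule injI)
    fix m n :: nat assume "ternary (\<lambda>i. i = m) = ternary (\<lambda>i. i = n)"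
    then have "(\<lambda>i. i = m) = (\<lambda>i. i = n)" by (rule injD[OF inj_ternary])
    then have "(m = m) = (m = n)" by (rule fun_cong)
    then show "m = n" by simp
  qed
  then have "infinite (range (\<lambda>n::nat. ternary (\<lambda>i. i = n)))" by (rule range_inj_infinite)
  moreover have "range (\<lambda>n::nat. ternary (\<lambda>i. i = n)) \<subseteq> cantor_set"
    by (auto simp: cantor_set_eq_range_ternary)
  ultimately show ?thesis using finite_subset by blast
qed

lemma is_cantor_set_infinite:
  assumes "is_cantor_set Y" shows "infinite (topspace Y)"
proof -
  obtain f where "homeomorphic_map Y (top_of_set cantor_set) f"
    using assms unfolding is_cantor_set_def homeomorphic_space by blast
  then have "f ` topspace Y = cantor_set" using homeomorphic_imp_surjective_map by fastforce
  then show ?thesis using infinite_cantor_set by (metis finite_imageI)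
qed

lemma not_totally_disconnected_if_circle_components:
  assumes "topspace Y \<noteq> {}"
    and "\<And>C. C \<in> connected_components_of Y \<Longrightarrow> subtopology Y C homeomorphic_space nsphere 1"
  shows "\<not> totally_disconnected_space Y"
proof
  assume td: "totally_disconnected_space Y"
  obtain C where C: "C \<in> connected_components_of Y"
    using assms(1) Union_connected_components_of[of Y] by blast
  then obtain p where "C = {p}" using td unfolding totally_disconnected_space_def by blast
  obtain f where "homeomorphic_map (subtopology Y C) (nsphere 1) f"
    using assms(2)[OF C] unfolding homeomorphic_space by blast
  then have "f ` (topspace Y \<inter> {p}) = topspace (nsphere 1)"
    using homeomorphic_imp_surjective_map \<open>C = {p}\<close> by fastforce
  then have sub: "topspace (nsphere 1) \<subseteq> {f p}" by blast
  have "(\<lambda>i. if i = 0 then 1 else 0) \<in> topspace (nsphere 1)"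
    "(\<lambda>i. if i = 0 then - 1 else 0) \<in> topspace (nsphere 1)"
    by (auto simp: nsphere)
  from this[THEN subsetD[OF sub], THEN singletonD]
  have "(\<lambda>i::nat. if i = 0 then 1 else 0) = (\<lambda>i::nat. if i = 0 then - 1 else (0::real))" by (rule trans[OF _ sym])
  from fun_cong[OF this, of 0] show False by simp
qed

text \<open>Each point has a whole plaque as a neighbourhood in \<open>S\<close>. Plaques are open
  discs, which gives the charts; they also make leaves open in \<open>S\<close>, so by minimality a
  single leaf is all of \<open>S\<close>.\<close>

lemma single_leaf_case:
  assumes min: "minimal_solenoid X k l A S" and all: "plaque_interior X A S = S" and ne: "S \<noteq> {}"
  shows "topological_manifold k (subtopology X S)" "\<exists>p\<in>S. S = leaf X A p"
proof -
  have S: "foliated_manifold X k l A" "compactin X S" "saturated X A S"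
    using min by (auto simp: minimal_solenoid_def solenoid_def)
  have SX: "S \<subseteq> topspace X" using S(2) compactin_subset_topspace by blast
  have local: "\<exists>W. openin (subtopology X S) W \<and> z \<in> W \<and> subtopology X W homeomorphic_space Euclidean_space k
      \<and> W \<subseteq> leaf X A z" if z: "z \<in> S" for z
  proof -
    have "z \<in> plaque_interior X A S" using z all by simp
    then obtain W \<psi> where W: "flat_box X k l A W \<psi>" "z \<in> W" "W \<inter> S = {v\<in>W. snd (\<psi> v) = snd (\<psi> z)}"
      by (rule plaque_interior_box[OF S(1,3)]) (rule that; assumption)
    have "openin (subtopology X S) (S \<inter> W)" by (rule openin_subtopology_Int2[OF flat_box_openin[OF W(1)]])
    moreover have "subtopology X (W \<inter> S) homeomorphic_space Euclidean_space k"
      using flat_box_plaque_homeomorphic[OF W(1) flat_box_snd_in_disc[OF W(1,2)]]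
        disc_homeomorphic_Euclidean_space homeomorphic_space_trans unfolding W(3) by blast
    moreover have "W \<inter> S \<subseteq> leaf X A z"
    proof
      fix v assume "v \<in> W \<inter> S"
      then have v: "v \<in> W" "snd (\<psi> z) = snd (\<psi> v)" unfolding W(3) by auto
      show "v \<in> leaf X A z"
        unfolding leaf_def same_leaf_def using flat_box_plaque_rel[OF W(1,2) v] by blast
    qed
    ultimately show ?thesis using z W(2) by (intro exI[of _ "W \<inter> S"]) (auto simp: Int_commute)
  qed
  show "topological_manifold k (subtopology X S)"
    unfolding topological_manifold_def
  proof (intro conjI ballI)
    show "Hausdorff_space (subtopology X S)" "second_countable (subtopology X S)"
      using S(1) Hausdorff_space_subtopology second_countable_subtopology
      by (auto simp: foliated_manifold_def)
    fix z assume "z \<in> topspace (subtopology X S)"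
    then have "z \<in> S" by simp
    from local[OF this] obtain W where W: "openin (subtopology X S) W" "z \<in> W"
      "subtopology X W homeomorphic_space Euclidean_space k" by blast
    have "W \<subseteq> S" using openin_subset[OF W(1)] by auto
    then have "subtopology (subtopology X S) W = subtopology X W"
      by (simp add: subtopology_subtopology Int_absorb1)
    then show "\<exists>U. openin (subtopology X S) U \<and> z \<in> U \<and> subtopology (subtopology X S) U homeomorphic_space Euclidean_space k"
      using W by metis
  qed
  obtain p where p: "p \<in> S" using ne by blast
  have pl: "p \<in> leaf X A p" by (simp add: leaf_def same_leaf_def)
  have sub: "leaf X A p \<subseteq> S" using S(3) p by (simp add: saturated_def)
  have "openin (subtopology X S) (leaf X A p)"
  proof (subst openin_subopen, intro ballI)
    fix z assume z: "z \<in> leaf X A p"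
    then obtain W where W: "openin (subtopology X S) W" "z \<in> W" "W \<subseteq> leaf X A z" using local[of z] sub by blast
    have "leaf X A z \<subseteq> leaf X A p" using z by (auto simp: leaf_def same_leaf_def intro: rtranclp_trans)
    then show "\<exists>T. openin (subtopology X S) T \<and> z \<in> T \<and> T \<subseteq> leaf X A p" using W by blast
  qed
  then have "leaf X A p = S"
    using minimal_solenoid_plaque_closed[OF min _ plaque_closed_leaf] pl by blast
  then show "\<exists>p\<in>S. S = leaf X A p" using p by blast
qed

text \<open>Inside an open \<open>S\<close> there is room for a flat box around every point; it
  serves both as a manifold chart and as a flow box whose transversal factor is the open
  disc.\<close>

lemma open_solenoid_case:
  assumes fm: "foliated_manifold X k 1 A" and S: "openin X S"
  shows "topological_manifold (k + 1) (subtopology X S)"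
    "\<forall>p\<in>S. \<exists>U \<phi> K. flow_box X k 1 A S U \<phi> K \<and> p \<in> U \<and> openin (Euclidean_space 1) K"
proof -
  have box: "\<exists>W \<psi>. flat_box X k 1 A W \<psi> \<and> p \<in> W \<and> W \<subseteq> S" if p: "p \<in> S" for p
    by (rule flat_box_exists[OF fm S p]) blast
  show "\<forall>p\<in>S. \<exists>U \<phi> K. flow_box X k 1 A S U \<phi> K \<and> p \<in> U \<and> openin (Euclidean_space 1) K"
    using box flat_box_flow_box[OF fm] openin_disc by meson
  show "topological_manifold (k + 1) (subtopology X S)"
    unfolding topological_manifold_def
  proof (intro conjI ballI)
    show "Hausdorff_space (subtopology X S)" "second_countable (subtopology X S)"
      using fm Hausdorff_space_subtopology second_countable_subtopology
      by (auto simp: foliated_manifold_def)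
    fix z assume "z \<in> topspace (subtopology X S)"
    then have "z \<in> S" by simp
    from box[OF this] obtain W \<psi> where W: "flat_box X k 1 A W \<psi>" "z \<in> W" "W \<subseteq> S" by blast
    have "openin (subtopology X S) W"
      using openin_subtopology_Int2[OF flat_box_openin[OF W(1)], of S] W(3) by (simp add: Int_absorb1)
    moreover have "subtopology (subtopology X S) W = subtopology X W"
      using W(3) by (simp add: subtopology_subtopology Int_absorb1)
    ultimately show "\<exists>U. openin (subtopology X S) U \<and> z \<in> U \<and> subtopology (subtopology X S) U homeomorphic_space Euclidean_space (k + 1)"
      using W(2) flat_box_homeomorphic_Euclidean_space[OF W(1)] by metis
  qed
qed

theorem mainTheorem6:
  fixes X :: "'a topology" and k :: nat and A :: "'a fchart set" and S T :: "'a set"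
  assumes "minimal_solenoid X k 1 A S"
    and "S \<noteq> {}"
    and "transversal X k 1 A S T"
    and "T \<noteq> {}"
  defines "case1 \<equiv>
      (finite (connected_components_of (subtopology X T)) \<and>
       (\<forall>C\<in>connected_components_of (subtopology X T). subtopology X C homeomorphic_space nsphere 1))
    \<and> (connectedin X S \<and> compactin X S \<and> topological_manifold (k + 1) (subtopology X S) \<and>
       (\<forall>p\<in>S. \<exists>U \<phi> K. flow_box X k 1 A S U \<phi> K \<and> p \<in> U \<and> openin (Euclidean_space 1) K))"
    and "case2a \<equiv> finite T \<and> connectedin X S \<and> compactin X S \<and>
       topological_manifold k (subtopology X S) \<and> (\<exists>p\<in>S. S = leaf X A p)"
    and "case2b \<equiv> is_cantor_set (subtopology X T)"
  shows "(case1 \<and> \<not> (totally_disconnected_space (subtopology X T) \<and> (case2a \<or> case2b)))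
       \<or> (\<not> case1 \<and> totally_disconnected_space (subtopology X T) \<and>
          ((case2a \<and> \<not> case2b) \<or> (case2b \<and> \<not> case2a)))"
proof -
  let ?Y = "subtopology X T"
  have S: "foliated_manifold X k 1 A" "compactin X S" "saturated X A S"
    using assms(1) by (auto simp: minimal_solenoid_def solenoid_def)
  have Haus: "Hausdorff_space X" and sc: "second_countable X" using S(1) by (auto simp: foliated_manifold_def)
  have conn: "connectedin X S" by (rule minimal_solenoid_connected[OF assms(1)])
  have T: "compactin X T" "T \<subseteq> S" "T \<subseteq> topspace X"
    using assms(3) compactin_subset_topspace by (auto simp: transversal_def)
  have topY: "topspace ?Y = T" using T(3) by auto
  have cptY: "compact_space ?Y" using T(1) by (simp add: compactin_subspace)
  have HausY: "Hausdorff_space ?Y" using Haus by (rule Hausdorff_space_subtopology)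
  have subC: "subtopology ?Y C = subtopology X C" if "C \<in> connected_components_of ?Y" for C
    using connected_components_of_subset[OF that] T(3)
    by (simp add: subtopology_subtopology Int_absorb1)
  \<comment> \<open>Both exclusions are settled before the case split: a circle has more than one
    point, and a Cantor set is infinite.\<close>
  have not_td: "\<not> totally_disconnected_space ?Y" if case1
    by (rule not_totally_disconnected_if_circle_components)
       (use that subC assms(4) topY in \<open>auto simp: case1_def\<close>)
  have not_both: "\<not> (case2a \<and> case2b)"
    using is_cantor_set_infinite[of ?Y] topY unfolding case2a_def case2b_def by auto
  show ?thesis
  proof (cases "X interior_of S = {}")
    case False
    have "openin (subtopology X S) (X interior_of S)"
      using openin_subtopology_Int2[OF openin_interior_of[of X S], of S] interior_of_subset[of X S]
      by (simp add: Int_absorb1)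
    then have "X interior_of S = S"
      using minimal_solenoid_plaque_closed[OF assms(1) _ plaque_closed_interior[OF S(3)] False] by blast
    then have opS: "openin X S" by (metis openin_interior_of)
    have arcs: "\<exists>g. open_arc ?Y g \<and> p \<in> range g" if "p \<in> topspace ?Y" for p
      using transversal_open_arc[OF assms(3) opS] that topY by blast
    have case1
      unfolding case1_def
      using compact_1_manifold_components_are_circles[OF HausY cptY arcs] subC conn S(2)
        open_solenoid_case[OF S(1) opS] by simp
    then show ?thesis using not_td by blast
  next
    case True
    have sep: "\<exists>C. openin ?Y C \<and> closedin ?Y C \<and> x \<in> C \<and> y \<notin> C"
      if "x \<in> topspace ?Y" "y \<in> topspace ?Y" "x \<noteq> y" for x y
      using transversal_clopen_separation[OF assms(3) Haus True] that unfolding topY by blast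
    have td: "totally_disconnected_space ?Y"
      by (rule totally_disconnected_if_clopen_separated) (rule sep)
    have "case2a \<or> case2b"
    proof (cases "\<exists>p\<in>T. openin ?Y {p}")
      case True
      then obtain p where "p \<in> T" "openin ?Y {p}" by blast
      then have "plaque_interior X A S \<noteq> {}"
        using isolated_in_transversal_imp_plaque_interior[OF S(1) assms(3)] by blast
      then have all: "plaque_interior X A S = S"
        using minimal_solenoid_plaque_closed[OF assms(1) openin_plaque_interior
            plaque_closed_plaque_interior[OF S(1,3)]] by blast
      \<comment> \<open>Isolation of one point of \<open>T\<close> has spread to all of
        \<open>S\<close> by minimality and now returns to every point of \<open>T\<close>.\<close>
      have "openin ?Y {p}" if "p \<in> topspace ?Y" for p
        by (rule plaque_interior_imp_isolated_in_transversal[OF S(1) assms(3)])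
           (use that topY T(2) all in auto)
      then have "finite T" using finite_if_compact_all_isolated[OF cptY] topY by simp
      then have case2a
        unfolding case2a_def using conn S(2) single_leaf_case[OF assms(1) all assms(2)] by blast
      then show ?thesis ..
    next
      case False
      have "?Y homeomorphic_space top_of_set cantor_set"
        by (rule homeomorphic_cantor_set[OF cptY second_countable_subtopology[OF sc] _ sep])
           (use assms(4) topY False in auto)
      then show ?thesis unfolding case2b_def is_cantor_set_def by blast
    qed
    then show ?thesis using td not_td not_both by blast
  qed
qed

end
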